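(* Let $K$ be a finite CW complex and $\mathcal V$ an acyclic discrete vector field on the CW structure $\mathcal K$ of $K$. Then the complexes $K$ and $K/\mathcal V$ (the Morse complex of $\mathcal V$, obtained by successively collapsing the vectors of $\mathcal V$ in a fixed order) are homotopy equivalent.
   Context: A finite CW complex is a Hausdorff space $K$ with a finite partition $\mathcal K$ of $K$ into cells and, for each cell $\sigma$ of dimension $|\sigma|$, a characteristic map $\varphi_\sigma:B^{|\sigma|}\to K$ (continuous, mapping the open ball homeomorphically onto $\sigma$, and mapping $S^{|\sigma|-1}$ into the union of cells of dimension at most $|\sigma|-1$). Characteristic maps may be freely replaced by their compositions with homeomorphisms onto $B^{|\sigma|}$ (in particular $B^{|\sigma|}$ may be replaced by any homeomorphic set). A subcomplex is a union of cells that is closed in $K$. A cell $\tau$ is a facet of $\sigma$ if $\tau\cap\operatorname{cl}\sigma\ne\emptyset$ and $|\tau|=|\sigma|-1$. Let $H^n_-=\{x\in S^{n-1}\mid x_n\le0\}$, $H^n_+=\{x\in S^{n-1}\mid x_n\ge0\}$. A facet $\alpha_0$ of an $n$-cell $\alpha_1$ is regular if $\varphi_{\alpha_1}$ satisfies: (i) $\varphi_{\alpha_1}(S^{n-1})$ is a subcomplex of $K$; (ii) $\varphi_{\alpha_1}|_{H^n_-}$ is the characteristic map of $\alpha_0$ (with $H^n_-$ in place of $B^{n-1}$); (iii) $\varphi_{\alpha_1}(H^n_+)\cap\alpha_0=\emptyset$. Then $\alpha=(\alpha_0,\alpha_1)$ is a reduction pair. A discrete vector field on $\mathcal K$ is a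 partition of $\mathcal K$ into singletons and doubletons such that each doubleton, ordered by dimension, is a reduction pair (a vector). It is identified with the injective partial self-map $\mathcal V$ of $\mathcal K$ sending the lower-dimensional cell of each doubleton to the other one. Let $G_{\mathcal V}$ be the directed graph on the cells with an edge from each $\sigma$ to each of its facets $\tau$, reversed if $\sigma=\mathcal V(\tau)$; $\mathcal V$ is acyclic if $G_{\mathcal V}$ has no directed cycle. For a reduction pair $\alpha$ with $n=|\alpha_1|$ put $\varphi_\alpha:=\varphi_{\alpha_1}$, $K_\alpha:=\operatorname{cl}\alpha_1$, $K_\alpha^+:=\varphi_\alpha(H^n_+)$. Fix a homeomorphism $\chi=(\chi_1,\chi_2):B^n\to B^{n-1}\times[0,1]$ with $\chi(H^n_-)=B^{n-1}\times\{1\}\cup S^{n-2}\times[0,1]$, $\chi(H^n_+)=B^{n-1}\times\{0\}$, and let $\chi_\alpha:=\varphi_\alpha\circ\chi^{-1}$. Define $f_\alpha:K_\alpha\to K_\alpha^+$ by $f_\alpha(x)=\chi_\alpha(\chi_1(\varphi_\alpha^{-1}(x)),0)$ for $x\in\alpha_0\cup\alpha_1$ and $f_\alpha(x)=x$ otherwise. Let $xR_\alpha y$ iff $x=y$ or ($x,y\in K_\alpha$ and $f_\alpha(x)=f_\alpha(y)$), with quotient map $\kappa_\alpha:K\to K/R_\alpha$. The $\alpha$-collapse $K/R_\alpha$ is a CW complex with cells $\kappa_\alpha(\sigma)$ and characteristic maps $\kappa_\alpha\circ\varphi_\sigma$ for $\sigma\in\mathcal K\setminus\{\alpha_0,\alpha_1\}$.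 If $\alpha$ is a vector of an acyclic $\mathcal V$, then the pairs $(\kappa_\alpha(\sigma),\kappa_\alpha(\mathcal V(\sigma)))$, $\sigma\in\operatorname{dom}\mathcal V\setminus\{\alpha_0\}$, are the vectors of an acyclic discrete vector field on $K/R_\alpha$. Morse complex: fix an ordering $(\alpha^1,\dots,\alpha^m)$ of the vectors of $\mathcal V$. Collapse $\alpha^1$ in $K$, then collapse (the image of) $\alpha^2$ in the resulting complex, and so on until (the image of) $\alpha^m$ has been collapsed. The resulting CW complex is denoted $K/\mathcal V$ (the ordering being implicit); its cells are in one-to-one correspondence with the critical cells (singletons) of $\mathcal V$. *)

theory Defs
  imports "HOL-Analysis.Analysis"
begin

section \<open>Balls, spheres and hemispheres\<close>

text \<open>As in the library, Euclidean n-space consists of the functions from nat to real that vanish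
  at all indices at least n, so the last coordinate of a point of n-space has index n - 1.
  Below, uball n is the closed n-ball and usphere n its boundary, the (n-1)-sphere;
  usphere 0 is empty.\<close>

definition uball :: "nat \<Rightarrow> (nat \<Rightarrow> real) set" where
  "uball n = {x \<in> topspace (Euclidean_space n). (\<Sum>i<n. (x i)\<^sup>2) \<le> 1}"

definition usphere :: "nat \<Rightarrow> (nat \<Rightarrow> real) set" where
  "usphere n = {x \<in> topspace (Euclidean_space n). (\<Sum>i<n. (x i)\<^sup>2) = 1}"

text \<open>The hemispheres are only used for n at least 1.\<close>

definition hemi_minus :: "nat \<Rightarrow> (nat \<Rightarrow> real) set" where
  "hemi_minus n = {x \<in> usphere n. x (n - 1) \<le> 0}"

definition hemi_plus :: "nat \<Rightarrow> (nat \<Rightarrow> real) set" where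
  "hemi_plus n = {x \<in> usphere n. x (n - 1) \<ge> 0}"

abbreviation ball_top :: "nat \<Rightarrow> (nat \<Rightarrow> real) topology" where
  "ball_top n \<equiv> subtopology (Euclidean_space n) (uball n)"


section \<open>Finite CW complexes\<close>

text \<open>Only the values of cw_dim and cw_char on cells, and of a characteristic map on the
  ball of the appropriate dimension, are meaningful.\<close>

record 'a cw =
  cw_space :: "'a topology"
  cw_cells :: "'a set set"
  cw_dim :: "'a set \<Rightarrow> nat"
  cw_char :: "'a set \<Rightarrow> (nat \<Rightarrow> real) \<Rightarrow> 'a"

definition finite_cw :: "'a cw \<Rightarrow> bool" where
  "finite_cw K \<longleftrightarrow>
     Hausdorff_space (cw_space K) \<and>
     finite (cw_cells K) \<and>
     partition_on (topspace (cw_space K)) (cw_cells K) \<and>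
     (\<forall>\<sigma>\<in>cw_cells K.
        continuous_map (ball_top (cw_dim K \<sigma>)) (cw_space K) (cw_char K \<sigma>) \<and>
        homeomorphic_map
          (subtopology (Euclidean_space (cw_dim K \<sigma>)) (uball (cw_dim K \<sigma>) - usphere (cw_dim K \<sigma>)))
          (subtopology (cw_space K) \<sigma>) (cw_char K \<sigma>) \<and>
        cw_char K \<sigma> ` usphere (cw_dim K \<sigma>) \<subseteq> \<Union>{\<tau> \<in> cw_cells K. cw_dim K \<tau> < cw_dim K \<sigma>})"

definition subcomplex :: "'a cw \<Rightarrow> 'a set \<Rightarrow> bool" where
  "subcomplex K A \<longleftrightarrow> (\<exists>S \<subseteq> cw_cells K. A = \<Union>S) \<and> closedin (cw_space K) A"

definition facet :: "'a cw \<Rightarrow> 'a set \<Rightarrow> 'a set \<Rightarrow> bool" where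
  "facet K \<tau> \<sigma> \<longleftrightarrow> \<tau> \<in> cw_cells K \<and> \<sigma> \<in> cw_cells K \<and>
     \<tau> \<inter> (cw_space K closure_of \<sigma>) \<noteq> {} \<and> cw_dim K \<sigma> = Suc (cw_dim K \<tau>)"

text \<open>Characteristic maps may be replaced by their compositions with self-homeomorphisms of the
  ball.\<close>

definition reparam :: "nat \<Rightarrow> ((nat \<Rightarrow> real) \<Rightarrow> 'a) \<Rightarrow> ((nat \<Rightarrow> real) \<Rightarrow> 'a) \<Rightarrow> bool" where
  "reparam n \<phi> \<psi> \<longleftrightarrow>
     (\<exists>g. homeomorphic_map (ball_top n) (ball_top n) g \<and> (\<forall>x\<in>uball n. \<psi> x = \<phi> (g x)))"


section \<open>Reduction pairs and discrete vector fields\<close>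

text \<open>The second conjunct says that the restriction of \<open>\<psi>\<close> to the lower hemisphere is the
  characteristic map of \<open>\<alpha>0\<close>, once that hemisphere is identified by some
  homeomorphism with the ball on which the latter map is defined.\<close>

definition adapted_char :: "'a cw \<Rightarrow> 'a set \<Rightarrow> 'a set \<Rightarrow> ((nat \<Rightarrow> real) \<Rightarrow> 'a) \<Rightarrow> bool" where
  "adapted_char K \<alpha>0 \<alpha>1 \<psi> \<longleftrightarrow>
     (let n = cw_dim K \<alpha>1 in
        subcomplex K (\<psi> ` usphere n) \<and>
        (\<exists>h. homeomorphic_map (subtopology (Euclidean_space n) (hemi_minus n)) (ball_top (n - 1)) h \<and>
             (\<forall>x\<in>hemi_minus n. \<psi> x = cw_char K \<alpha>0 (h x))) \<and>
        \<psi> ` hemi_plus n \<inter> \<alpha>0 = {})"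

definition reduction_pair :: "'a cw \<Rightarrow> 'a set \<Rightarrow> 'a set \<Rightarrow> bool" where
  "reduction_pair K \<alpha>0 \<alpha>1 \<longleftrightarrow> facet K \<alpha>0 \<alpha>1 \<and>
     (\<exists>\<psi>. reparam (cw_dim K \<alpha>1) (cw_char K \<alpha>1) \<psi> \<and> adapted_char K \<alpha>0 \<alpha>1 \<psi>)"

definition discrete_vector_field :: "'a cw \<Rightarrow> 'a set set set \<Rightarrow> bool" where
  "discrete_vector_field K V \<longleftrightarrow> partition_on (cw_cells K) V \<and>
     (\<forall>D\<in>V. (\<exists>\<sigma>. D = {\<sigma>}) \<or> (\<exists>\<sigma> \<tau>. D = {\<sigma>, \<tau>} \<and> reduction_pair K \<sigma> \<tau>))"

text \<open>The doubletons of V ordered by dimension; this is the graph of V viewed as a partial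
  self-map of the set of cells.\<close>

definition vectors :: "'a cw \<Rightarrow> 'a set set set \<Rightarrow> ('a set \<times> 'a set) set" where
  "vectors K V = {(\<sigma>, \<tau>). {\<sigma>, \<tau>} \<in> V \<and> cw_dim K \<sigma> < cw_dim K \<tau>}"

definition dvf_graph :: "'a cw \<Rightarrow> 'a set set set \<Rightarrow> ('a set \<times> 'a set) set" where
  "dvf_graph K V =
     {(\<sigma>, \<tau>). facet K \<tau> \<sigma> \<and> (\<tau>, \<sigma>) \<notin> vectors K V} \<union>
     {(\<tau>, \<sigma>). facet K \<tau> \<sigma> \<and> (\<tau>, \<sigma>) \<in> vectors K V}"

definition acyclic_dvf :: "'a cw \<Rightarrow> 'a set set set \<Rightarrow> bool" where
  "acyclic_dvf K V \<longleftrightarrow> discrete_vector_field K V \<and> acyclic (dvf_graph K V)"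


section \<open>Quotient spaces\<close>

text \<open>To be able to iterate quotients within one type, the quotient of X by an equivalence
  relation R is modelled on a set of representatives: each R-class is coded by one chosen element
  of it, and the topology is the final one with respect to the projection.\<close>

definition quot_proj :: "('a \<Rightarrow> 'a \<Rightarrow> bool) \<Rightarrow> 'a \<Rightarrow> 'a" where
  "quot_proj R x = (SOME y. R x y)"

definition quot_top :: "'a topology \<Rightarrow> ('a \<Rightarrow> 'a \<Rightarrow> bool) \<Rightarrow> 'a topology" where
  "quot_top X R = topology (\<lambda>U. U \<subseteq> quot_proj R ` topspace X \<and>
                                  openin X {x \<in> topspace X. quot_proj R x \<in> U})"

lemma quot_proj_eq_iff:
  assumes "equivp R"
  shows "quot_proj R x = quot_proj R y \<longleftrightarrow> R x y"
proof -
  have *: "R z (quot_proj R z)" for z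
    unfolding quot_proj_def using equivp_reflp[OF assms, of z] by (rule someI)
  show ?thesis
  proof
    assume "quot_proj R x = quot_proj R y"
    then show "R x y"
      using *[of x] *[of y] equivp_symp[OF assms] equivp_transp[OF assms] by metis
  next
    assume "R x y"
    then have "R x = R y"
      using assms by (simp add: equivp_def)
    then show "quot_proj R x = quot_proj R y"
      by (simp add: quot_proj_def)
  qed
qed

lemma openin_quot_top:
  "openin (quot_top X R) U \<longleftrightarrow>
     U \<subseteq> quot_proj R ` topspace X \<and> openin X {x \<in> topspace X. quot_proj R x \<in> U}"
proof -
  let ?P = "\<lambda>U. U \<subseteq> quot_proj R ` topspace X \<and> openin X {x \<in> topspace X. quot_proj R x \<in> U}"
  have "istopology ?P"
    unfolding istopology_def
  proof (intro conjI allI impI)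
    fix S T assume S: "?P S" and T: "?P T"
    show "S \<inter> T \<subseteq> quot_proj R ` topspace X"
      using S by blast
    have "{x \<in> topspace X. quot_proj R x \<in> S \<inter> T} =
          {x \<in> topspace X. quot_proj R x \<in> S} \<inter> {x \<in> topspace X. quot_proj R x \<in> T}"
      by blast
    then show "openin X {x \<in> topspace X. quot_proj R x \<in> S \<inter> T}"
      using S T by (simp add: openin_Int)
  next
    fix \<K> assume K: "\<forall>U\<in>\<K>. ?P U"
    then show "\<Union>\<K> \<subseteq> quot_proj R ` topspace X"
      by blast
    have eq: "{x \<in> topspace X. quot_proj R x \<in> \<Union>\<K>} =
          (\<Union>U\<in>\<K>. {x \<in> topspace X. quot_proj R x \<in> U})"
      by blast
    show "openin X {x \<in> topspace X. quot_proj R x \<in> \<Union>\<K>}"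
      unfolding eq using K by (intro openin_Union) blast
  qed
  then show ?thesis
    by (simp add: quot_top_def topology_inverse')
qed

lemma quotient_map_quot_proj: "quotient_map X (quot_top X R) (quot_proj R)"
proof -
  have "{x \<in> topspace X. quot_proj R x \<in> quot_proj R ` topspace X} = topspace X"
    by blast
  then have "openin (quot_top X R) (quot_proj R ` topspace X)"
    by (simp add: openin_quot_top)
  then have "topspace (quot_top X R) = quot_proj R ` topspace X"
    by (metis openin_quot_top openin_subset openin_topspace subset_antisym)
  then show ?thesis
    by (auto simp: quotient_map_def openin_quot_top)
qed


section \<open>Collapses and the Morse complex\<close>

definition cylinder_homeo :: "nat \<Rightarrow> ((nat \<Rightarrow> real) \<Rightarrow> (nat \<Rightarrow> real) \<times> real) \<Rightarrow> bool" where
  "cylinder_homeo n chi \<longleftrightarrow>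
     homeomorphic_map (ball_top n) (prod_topology (ball_top (n - 1)) (top_of_set {0..1})) chi \<and>
     chi ` hemi_minus n = uball (n - 1) \<times> {1} \<union> usphere (n - 1) \<times> {0..1} \<and>
     chi ` hemi_plus n = uball (n - 1) \<times> {0}"

text \<open>In the following definitions \<open>chi n\<close> is the fixed homeomorphism of the n-ball onto the
  cylinder, and \<open>cw_char K \<alpha>1\<close> is required to be adapted to \<open>(\<alpha>0, \<alpha>1)\<close>.
  This makes the preimages under \<open>cw_char K \<alpha>1\<close> occurring in collapse_fun unique.\<close>

definition collapse_fun ::
  "(nat \<Rightarrow> (nat \<Rightarrow> real) \<Rightarrow> (nat \<Rightarrow> real) \<times> real) \<Rightarrow> 'a cw \<Rightarrow> 'a set \<times> 'a set \<Rightarrow> 'a \<Rightarrow> 'a" where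
  "collapse_fun chi K = (\<lambda>(\<alpha>0, \<alpha>1) x.
     let n = cw_dim K \<alpha>1; \<phi> = cw_char K \<alpha>1 in
       if x \<in> \<alpha>0 \<union> \<alpha>1
       then \<phi> (inv_into (uball n) (chi n) (fst (chi n (inv_into (uball n) \<phi> x)), 0))
       else x)"

definition collapse_rel ::
  "(nat \<Rightarrow> (nat \<Rightarrow> real) \<Rightarrow> (nat \<Rightarrow> real) \<times> real) \<Rightarrow> 'a cw \<Rightarrow> 'a set \<times> 'a set \<Rightarrow> 'a \<Rightarrow> 'a \<Rightarrow> bool" where
  "collapse_rel chi K \<alpha> x y \<longleftrightarrow> x = y \<or>
     (x \<in> cw_space K closure_of snd \<alpha> \<and> y \<in> cw_space K closure_of snd \<alpha> \<and>
      collapse_fun chi K \<alpha> x = collapse_fun chi K \<alpha> y)"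

lemma equivp_collapse_rel: "equivp (collapse_rel chi K \<alpha>)"
  by (rule equivpI) (auto simp: reflp_def symp_def transp_def collapse_rel_def)

definition collapse_proj ::
  "(nat \<Rightarrow> (nat \<Rightarrow> real) \<Rightarrow> (nat \<Rightarrow> real) \<times> real) \<Rightarrow> 'a cw \<Rightarrow> 'a set \<times> 'a set \<Rightarrow> 'a \<Rightarrow> 'a" where
  "collapse_proj chi K \<alpha> = quot_proj (collapse_rel chi K \<alpha>)"

text \<open>Distinct remaining cells have distinct images under the projection, so that a cell c of the
  collapse determines the cell of K it comes from; inv_into recovers the latter.\<close>

definition collapse ::
  "(nat \<Rightarrow> (nat \<Rightarrow> real) \<Rightarrow> (nat \<Rightarrow> real) \<times> real) \<Rightarrow> 'a cw \<Rightarrow> 'a set \<times> 'a set \<Rightarrow> 'a cw" where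
  "collapse chi K \<alpha> =
     (let \<kappa> = collapse_proj chi K \<alpha>;
          C = cw_cells K - {fst \<alpha>, snd \<alpha>};
          src = inv_into C ((`) \<kappa>)
      in \<lparr> cw_space = quot_top (cw_space K) (collapse_rel chi K \<alpha>),
           cw_cells = (`) \<kappa> ` C,
           cw_dim = (\<lambda>c. cw_dim K (src c)),
           cw_char = (\<lambda>c. \<kappa> \<circ> cw_char K (src c)) \<rparr>)"

text \<open>After collapsing a pair, the remaining pairs are replaced by their images.\<close>

fun morse_complex ::
  "(nat \<Rightarrow> (nat \<Rightarrow> real) \<Rightarrow> (nat \<Rightarrow> real) \<times> real) \<Rightarrow> 'a cw \<Rightarrow> ('a set \<times> 'a set) list \<Rightarrow> 'a cw" where
  "morse_complex chi K [] = K"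
| "morse_complex chi K (\<alpha> # \<alpha>s) =
     morse_complex chi (collapse chi K \<alpha>)
       (map (map_prod ((`) (collapse_proj chi K \<alpha>)) ((`) (collapse_proj chi K \<alpha>))) \<alpha>s)"

end

theory Submission
  imports Defs "HOL-Homology.Invariance_of_Domain"
begin

text \<open>
  A single collapse is a homotopy equivalence because it contracts the fibres of a deformation
  retraction. In the closed cell \<open>K\<^sub>\<alpha> = cl \<alpha>1\<close> of a reduction pair \<open>(\<alpha>0, \<alpha>1)\<close>, the homeomorphism
  \<open>chi\<close> of the ball with a cylinder allows pushing every point down along a segment until it
  reaches the image \<open>Kplus\<close> of the upper hemisphere. The characteristic map \<open>\<phi>\<close> of \<open>\<alpha>1\<close> is
  injective away from that hemisphere (\<open>\<phi>_inj\<close>), and points of the hemisphere do not move, so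
  the motion is well defined on \<open>K\<^sub>\<alpha>\<close>; it starts at the identity, ends at the retraction \<open>f\<close> and
  stays inside the fibres of \<open>f\<close>. As \<open>K\<^sub>\<alpha>\<close> is a subcomplex, the motion extends to a homotopy of
  all of \<open>K\<close> which starts at the identity (\<open>subcomplex_homotopy_extension\<close>). The end of this
  homotopy is constant on the fibres and thus factors through the quotient, and the factor is a
  homotopy inverse of the projection (\<open>homotopy_equivalent_quotient\<close>): one of the two homotopies
  is the extended one, the other one is what it induces on the quotient.

  Injectivity of \<open>\<phi>\<close> on the open lower hemisphere rests on invariance of domain. An adapted map
  is the characteristic map of \<open>\<alpha>0\<close> there only up to some homeomorphism of the hemisphere with a
  ball, and it has to be shown that this homeomorphism takes interior points to interior points
  (\<open>hemi_minus_homeomorphism_interior\<close>).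

  For the induction over the list of vectors, the collapsed complex must again be a finite CW
  complex (\<open>finite_cw_K'\<close>) in which the remaining pairs are adapted and acyclic. Both properties
  of the pairs come from the one way in which a collapse creates new incidences. If a cell \<open>\<tau>\<close>
  becomes a facet of \<open>\<sigma>\<close>, then \<open>\<sigma>\<close> had the facet \<open>\<alpha>0\<close> and \<open>\<tau>\<close> was a facet of \<open>\<alpha>1\<close>, so that the
  new edge from \<open>\<sigma>\<close> to \<open>\<tau>\<close> replaces the path \<open>\<sigma> \<rightarrow> \<alpha>0 \<rightarrow> \<alpha>1 \<rightarrow> \<tau>\<close> (\<open>facet_K'D\<close>). Hence closed
  paths lift to closed paths. A remaining pair \<open>(\<beta>0, \<beta>1)\<close> stays adapted unless the upper hemisphere of \<open>\<beta>1\<close> runs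
  into the image of \<open>\<beta>0\<close>; this would mean that \<open>\<beta>1\<close> has the facet \<open>\<alpha>0\<close> and \<open>\<alpha>1\<close> the facet \<open>\<beta>0\<close>,
  which gives the cycle \<open>\<alpha>1 \<rightarrow> \<beta>0 \<rightarrow> \<beta>1 \<rightarrow> \<alpha>0 \<rightarrow> \<alpha>1\<close> (\<open>adapted_K'\<close>).
\<close>


section \<open>Balls and spheres\<close>

definition radius :: "nat \<Rightarrow> (nat \<Rightarrow> real) \<Rightarrow> real" where
  "radius n x = sqrt (\<Sum>i<n. (x i)\<^sup>2)"

lemma radius_nonneg: "0 \<le> radius n x"
  by (simp add: radius_def sum_nonneg)

lemma radius_scale: "0 \<le> c \<Longrightarrow> radius n (\<lambda>i. c * x i) = c * radius n x"
  by (simp add: radius_def power_mult_distrib real_sqrt_mult flip: sum_distrib_left)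

lemma in_uball_iff: "x \<in> uball n \<longleftrightarrow> (\<forall>i\<ge>n. x i = 0) \<and> radius n x \<le> 1"
  by (auto simp: uball_def topspace_Euclidean_space radius_def)

lemma in_usphere_iff: "x \<in> usphere n \<longleftrightarrow> (\<forall>i\<ge>n. x i = 0) \<and> radius n x = 1"
  by (auto simp: usphere_def topspace_Euclidean_space radius_def)

lemma usphere_subset_uball: "usphere n \<subseteq> uball n"
  by (auto simp: in_uball_iff in_usphere_iff)

text \<open>The abstract product topology on functions is the topology of the type class, so that
  continuity on balls can be treated with \<^const>\<open>continuous_on\<close>.\<close>

lemma Euclidean_space_eq: "Euclidean_space n = top_of_set {x. \<forall>i\<ge>n. x i = 0}"
  by (simp add: Euclidean_space_def euclidean_product_topology)

lemma subtopology_Euclidean_space_eq: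
  assumes "S \<subseteq> uball n"
  shows "subtopology (Euclidean_space n) S = top_of_set S"
proof -
  have "{x. \<forall>i\<ge>n. x i = 0} \<inter> S = S"
    using assms by (auto simp: in_uball_iff)
  then show ?thesis
    by (simp add: Euclidean_space_eq subtopology_subtopology)
qed

lemma ball_top_eq: "ball_top n = top_of_set (uball n)"
  by (simp add: subtopology_Euclidean_space_eq)

lemma continuous_on_radius:
  "continuous_on S f \<Longrightarrow> continuous_on S (\<lambda>x. radius n (f x))"
  unfolding radius_def by (intro continuous_intros)
    (rule continuous_on_product_then_coordinatewise)

lemma compact_uball: "compact (uball n)"
proof -
  let ?C = "PiE UNIV (\<lambda>_. {-1..1}) :: (nat \<Rightarrow> real) set"
  have "compactin (powertop_real UNIV) ?C"
    by (simp add: compactin_PiE)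
  then have C: "compact ?C"
    by (simp add: euclidean_product_topology)
  have eq: "uball n = {x. \<forall>i\<ge>n. x i = 0} \<inter> {x. radius n x \<le> 1}"
    by (auto simp: in_uball_iff)
  have "closed {x::nat \<Rightarrow> real. \<forall>i\<ge>n. x i = 0}"
    using closedin_Euclidean_space[of n]
    by (simp add: euclidean_product_topology topspace_Euclidean_space)
  moreover have "closed {x::nat \<Rightarrow> real. radius n x \<le> 1}"
    by (rule closed_Collect_le[OF continuous_on_radius[OF continuous_on_id] continuous_on_const])
  ultimately have "closed (uball n)"
    unfolding eq by (rule closed_Int)
  have "uball n \<subseteq> ?C"
  proof
    fix x assume x: "x \<in> uball n"
    have "-1 \<le> x i \<and> x i \<le> 1" for i
    proof (cases "i < n")
      case True
      then have "(x i)\<^sup>2 \<le> (\<Sum>i<n. (x i)\<^sup>2)"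
        by (intro member_le_sum) auto
      also have "\<dots> \<le> 1" using x by (simp add: uball_def)
      finally have "\<bar>x i\<bar> \<le> 1" by (simp add: abs_square_le_1)
      then show ?thesis by linarith
    next
      case False
      then show ?thesis using x by (simp add: in_uball_iff)
    qed
    then show "x \<in> ?C" by (simp add: PiE_iff)
  qed
  then have "?C \<inter> uball n = uball n" by blast
  moreover have "compact (?C \<inter> uball n)"
    using C \<open>closed (uball n)\<close> by (rule compact_Int_closed)
  ultimately show ?thesis by simp
qed

lemma scaling_tendsto:
  fixes x :: "nat \<Rightarrow> real" and c :: "nat \<Rightarrow> real"
  assumes "c \<longlonglongrightarrow> 1"
  shows "(\<lambda>k i. c k * x i) \<longlonglongrightarrow> x"
proof -
  have "continuous_on UNIV (\<lambda>c::real. \<lambda>i. c * x i)"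
    by (intro continuous_on_coordinatewise_then_product continuous_intros)
  from continuous_on_tendsto_compose[OF this assms] show ?thesis
    by simp
qed

text \<open>Rescaling a point of the sphere by factors below 1 approaches it from inside. This is what
  makes the closure of a cell equal to the image of the closed ball.\<close>

lemma open_ball_dense:
  assumes "x \<in> uball n"
  shows "x \<in> ball_top n closure_of (uball n - usphere n)"
proof -
  let ?s = "\<lambda>k. \<lambda>i. (1 - inverse (real (Suc k))) * x i"
  have "(\<lambda>k. 1 - inverse (real (Suc k))) \<longlonglongrightarrow> 1 - 0"
    by (intro tendsto_intros LIMSEQ_inverse_real_of_nat)
  then have "?s \<longlonglongrightarrow> x"
    by (intro scaling_tendsto) simp
  moreover have "?s k \<in> uball n - usphere n" for k
  proof -
    have "radius n (?s k) = (1 - inverse (real (Suc k))) * radius n x"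
      by (rule radius_scale) (simp add: field_simps)
    also have "\<dots> \<le> (1 - inverse (real (Suc k))) * 1"
      using assms by (intro mult_left_mono) (auto simp: in_uball_iff field_simps)
    also have "\<dots> < 1" by simp
    finally show ?thesis using assms by (auto simp: in_uball_iff in_usphere_iff)
  qed
  ultimately have "x \<in> closure (uball n - usphere n)"
    unfolding closure_sequential by (intro exI[of _ ?s] conjI allI)
  moreover have "uball n \<inter> (uball n - usphere n) = uball n - usphere n"
    by blast
  then have "top_of_set (uball n) closure_of (uball n - usphere n)
      = uball n \<inter> closure (uball n - usphere n)"
    by (simp add: closure_of_subtopology)
  ultimately show ?thesis
    unfolding ball_top_eq using assms by blast
qed

text \<open>By invariance of domain the image is open, and an open set that contains a point of the
  sphere also contains points slightly further out, which do not lie in the ball. The lemma serves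
  to recognise interior points of balls without knowing anything about the map but injectivity.\<close>

lemma injective_into_ball_avoids_sphere:
  assumes U: "openin (Euclidean_space n) U"
    and f: "continuous_map (subtopology (Euclidean_space n) U) (Euclidean_space n) f" "inj_on f U"
    and "f ` U \<subseteq> uball n"
  shows "f ` U \<inter> usphere n = {}"
proof (rule ccontr)
  assume "f ` U \<inter> usphere n \<noteq> {}"
  then obtain y where y: "y \<in> f ` U" "y \<in> usphere n" by blast
  have "openin (Euclidean_space n) (f ` U)"
    using U f by (rule invariance_of_domain_Euclidean_space)
  then obtain T where T: "open T" "f ` U = {x. \<forall>i\<ge>n. x i = 0} \<inter> T"
    unfolding Euclidean_space_eq openin_open by blast
  let ?s = "\<lambda>k. \<lambda>i. (1 + inverse (real (Suc k))) * y i"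
  have "(\<lambda>k. 1 + inverse (real (Suc k))) \<longlonglongrightarrow> 1 + 0"
    by (intro tendsto_intros LIMSEQ_inverse_real_of_nat)
  then have "?s \<longlonglongrightarrow> y"
    by (intro scaling_tendsto) simp
  then have "\<forall>\<^sub>F k in sequentially. ?s k \<in> T"
    using T y by (intro topological_tendstoD) auto
  then obtain k where "?s k \<in> T"
    using eventually_happens by fastforce
  then have "?s k \<in> uball n"
    using T y assms(4) by (auto simp: in_usphere_iff subset_iff)
  moreover have "radius n (?s k) = 1 + inverse (real (Suc k))"
    using y by (subst radius_scale) (auto simp: in_usphere_iff)
  ultimately show False
    by (auto simp: in_uball_iff)
qed


section \<open>Homotopies on a ball\<close>

abbreviation unit_top :: "real topology" where
  "unit_top \<equiv> top_of_set {0..1}"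

text \<open>The cylinder over the ball retracts onto its bottom and side by projection from the point
  \<open>(2, 0)\<close> above its top. The ray from there through \<open>(t, x)\<close> leaves the cylinder at the
  parameter \<open>1 / cyl_scale n t x\<close>: at the bottom if the first term of the maximum is the larger one,
  through the side otherwise.\<close>

definition cyl_scale :: "nat \<Rightarrow> real \<Rightarrow> (nat \<Rightarrow> real) \<Rightarrow> real" where
  "cyl_scale n t x = max (1 - t / 2) (radius n x)"

definition cyl_retract :: "nat \<Rightarrow> real \<times> (nat \<Rightarrow> real) \<Rightarrow> real \<times> (nat \<Rightarrow> real)" where
  "cyl_retract n = (\<lambda>(t, x). (2 - (2 - t) / cyl_scale n t x, \<lambda>i. x i / cyl_scale n t x))"

lemma prod_unit_ball: "prod_topology unit_top (ball_top n) = top_of_set ({0..1} \<times> uball n)"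
  by (simp add: ball_top_eq prod_topology_subtopology_eu)

lemma radius_divide: "0 < c \<Longrightarrow> radius n (\<lambda>i. x i / c) = radius n x / c"
  using radius_scale[of "1 / c" n x] by simp

lemma cyl_scale_pos: "t \<in> {0..1} \<Longrightarrow> 0 < cyl_scale n t x"
  by (simp add: cyl_scale_def less_max_iff_disj)

lemma cyl_retract_in:
  assumes "t \<in> {0..1}" "x \<in> uball n"
  shows "cyl_retract n (t, x) \<in> {0..1} \<times> uball n"
proof -
  let ?m = "cyl_scale n t x"
  have m: "0 < ?m" using cyl_scale_pos assms by blast
  have cyl_ge: "2 - t \<le> 2 * ?m" "radius n x \<le> ?m"
    by (auto simp: cyl_scale_def max_def)
  have "(2 - t) / ?m \<le> 2"
    using m cyl_ge by (simp add: pos_divide_le_eq)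
  moreover have "?m \<le> 1"
    using assms by (auto simp: cyl_scale_def in_uball_iff)
  then have "1 \<le> (2 - t) / ?m"
    using m assms by (simp add: pos_le_divide_eq)
  moreover have "radius n (\<lambda>i. x i / ?m) \<le> 1"
    using m cyl_ge by (simp add: radius_divide)
  ultimately show ?thesis
    using assms by (auto simp: cyl_retract_def in_uball_iff)
qed

lemma cyl_retract_bottom: "x \<in> uball n \<Longrightarrow> cyl_retract n (0, x) = (0, x)"
  by (simp add: cyl_retract_def cyl_scale_def in_uball_iff)

lemma cyl_retract_side: "t \<in> {0..1} \<Longrightarrow> x \<in> usphere n \<Longrightarrow> cyl_retract n (t, x) = (t, x)"
  by (simp add: cyl_retract_def cyl_scale_def in_usphere_iff)

lemma cyl_retract_to_bottom:
  "t \<in> {0..1} \<Longrightarrow> radius n x \<le> 1 - t / 2 \<Longrightarrow> fst (cyl_retract n (t, x)) = 0"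
  by (simp add: cyl_retract_def cyl_scale_def max_absorb1 field_simps)

lemma cyl_retract_to_side:
  assumes "t \<in> {0..1}" "x \<in> uball n" "1 - t / 2 \<le> radius n x"
  shows "snd (cyl_retract n (t, x)) \<in> usphere n"
proof -
  have m: "cyl_scale n t x = radius n x" "0 < radius n x"
    using assms by (auto simp: cyl_scale_def)
  then show ?thesis
    using assms by (simp add: cyl_retract_def in_usphere_iff in_uball_iff radius_divide)
qed

lemma continuous_cyl_retract:
  "continuous_map (prod_topology unit_top (ball_top n)) (prod_topology unit_top (ball_top n)) (cyl_retract n)"
proof -
  have coord: "continuous_on ({0..1} \<times> uball n) (\<lambda>p. snd p i)" for i
    using continuous_on_product_then_coordinatewise[OF continuous_on_snd[OF continuous_on_id]] .
  have scale: "continuous_on ({0..1} \<times> uball n) (\<lambda>p. cyl_scale n (fst p) (snd p))"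
    unfolding cyl_scale_def
    by (intro continuous_on_max continuous_on_radius continuous_on_diff continuous_on_divide
        continuous_on_const continuous_on_fst continuous_on_snd continuous_on_id) auto
  have nz: "\<forall>p\<in>{0..1} \<times> uball n. cyl_scale n (fst p) (snd p) \<noteq> 0"
    using cyl_scale_pos by (force simp: less_le)
  have "continuous_on ({0..1} \<times> uball n) (\<lambda>p. (2 - (2 - fst p) / cyl_scale n (fst p) (snd p),
            \<lambda>i. snd p i / cyl_scale n (fst p) (snd p)))"
    by (intro continuous_on_Pair continuous_on_coordinatewise_then_product continuous_on_divide
        continuous_on_diff continuous_on_const continuous_on_fst continuous_on_id coord scale nz)
  then have "continuous_on ({0..1} \<times> uball n) (cyl_retract n)"
    by (simp add: cyl_retract_def case_prod_unfold)
  moreover have "cyl_retract n \<in> {0..1} \<times> uball n \<rightarrow> {0..1} \<times> uball n"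
    using cyl_retract_in by (auto simp only: Pi_iff split_paired_all mem_Sigma_iff)
  ultimately show ?thesis
    unfolding prod_unit_ball by (simp add: continuous_map_in_subtopology image_subset_iff_funcset)
qed

text \<open>The data are a map on the bottom and side of the cylinder; composing it with the retraction
  extends it to the whole cylinder.\<close>

lemma ball_homotopy_extension:
  assumes f: "continuous_map (ball_top n) Y f"
    and H: "continuous_map (prod_topology unit_top (subtopology (ball_top n) (usphere n))) Y H"
    and H0: "\<And>x. x \<in> usphere n \<Longrightarrow> H (0, x) = f x"
  obtains G where "continuous_map (prod_topology unit_top (ball_top n)) Y G"
    "\<And>x. x \<in> uball n \<Longrightarrow> G (0, x) = f x"
    "\<And>t x. t \<in> {0..1} \<Longrightarrow> x \<in> usphere n \<Longrightarrow> G (t, x) = H (t, x)"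
proof
  let ?X = "prod_topology unit_top (ball_top n)" and ?r = "cyl_retract n"
  \<comment> \<open>Where \<open>?p \<le> ?q\<close> the retraction ends on the bottom, where \<open>?q \<le> ?p\<close> on the side.\<close>
  let ?p = "\<lambda>z. radius n (snd z)" and ?q = "\<lambda>z. 1 - fst z / 2"
  let ?G = "\<lambda>z. if ?p z \<le> ?q z then f (snd (?r z)) else H (?r z)"
  have top: "topspace ?X = {0..1} \<times> uball n"
    by (simp add: ball_top_eq)
  show "continuous_map ?X Y ?G"
  proof (rule continuous_map_cases_le)
    show "continuous_map ?X euclideanreal ?p" "continuous_map ?X euclideanreal ?q"
      unfolding prod_unit_ball continuous_map_iff_continuous
      by (intro continuous_on_radius continuous_on_diff continuous_on_divide
        continuous_on_const continuous_on_fst continuous_on_snd continuous_on_id; simp)+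
    have "continuous_map ?X (ball_top n) (snd \<circ> ?r)"
      using continuous_cyl_retract continuous_map_snd by (rule continuous_map_compose)
    then have "continuous_map ?X Y (f \<circ> (snd \<circ> ?r))"
      using f by (rule continuous_map_compose)
    then show "continuous_map (subtopology ?X {z \<in> topspace ?X. ?p z \<le> ?q z}) Y (\<lambda>z. f (snd (?r z)))"
      using continuous_map_from_subtopology by (fastforce simp: o_def)
    have "continuous_map (subtopology ?X {z \<in> topspace ?X. ?q z \<le> ?p z})
            (subtopology ?X ({0..1} \<times> usphere n)) ?r"
      unfolding continuous_map_in_subtopology
    proof
      show "continuous_map (subtopology ?X {z \<in> topspace ?X. ?q z \<le> ?p z}) ?X ?r"
        using continuous_cyl_retract by (rule continuous_map_from_subtopology)
      show "?r \<in> topspace (subtopology ?X {z \<in> topspace ?X. ?q z \<le> ?p z}) \<rightarrow> {0..1} \<times> usphere n"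
        using cyl_retract_to_side cyl_retract_in by (fastforce simp: top mem_Times_iff)
    qed
    moreover have "subtopology ?X ({0..1} \<times> usphere n) = prod_topology unit_top (subtopology (ball_top n) (usphere n))"
      by (simp add: prod_topology_subtopology subtopology_subtopology Times_Int_Times Int_assoc)
    ultimately show "continuous_map (subtopology ?X {z \<in> topspace ?X. ?q z \<le> ?p z}) Y (\<lambda>z. H (?r z))"
      using H continuous_map_compose by (fastforce simp: o_def)
    show "f (snd (?r z)) = H (?r z)" if z: "z \<in> topspace ?X" "?p z = ?q z" for z
    proof -
      obtain t x where [simp]: "z = (t, x)" by fastforce
      have tx: "t \<in> {0..1}" "x \<in> uball n" using z top by auto
      have "fst (?r z) = 0" "snd (?r z) \<in> usphere n"
        using cyl_retract_to_bottom[of t n x] cyl_retract_to_side[of t x n] tx z by auto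
      then show ?thesis using H0 by (metis prod.collapse)
    qed
  qed
  show "?G (0, x) = f x" if "x \<in> uball n" for x
    using that by (simp add: cyl_retract_bottom in_uball_iff)
  show "?G (t, x) = H (t, x)" if t: "t \<in> {0..1}" and x: "x \<in> usphere n" for t x
  proof (cases "t = 0")
    case True
    then show ?thesis
      using x H0[of x] usphere_subset_uball by (auto simp: cyl_retract_side)
  next
    case False
    then have "\<not> radius n x \<le> 1 - t / 2" using t x by (simp add: in_usphere_iff)
    then show ?thesis using t x by (simp add: cyl_retract_side)
  qed
qed


section \<open>Collapsing the fibres of a deformation retraction\<close>

text \<open>Homotopies on a quotient can be defined upstairs, since the unit interval is locally compact.\<close>

lemma quotient_map_cylinder:
  assumes "quotient_map X Y f"
  shows "quotient_map (prod_topology unit_top X) (prod_topology unit_top Y) (\<lambda>(t, x). (t, f x))"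
  by (intro quotient_map_prod_right assms)
    (auto intro!: compact_imp_locally_compact_space simp: compact_space_subtopology Hausdorff_space_subtopology)

text \<open>The homotopy extension property of the pair of \<open>X\<close> and \<open>A\<close> with respect to the single target \<open>Y\<close>; a
  predicate cannot quantify over all target types.\<close>

definition homotopy_extension :: "'a topology \<Rightarrow> 'a set \<Rightarrow> 'b topology \<Rightarrow> bool" where
  "homotopy_extension X A Y \<longleftrightarrow>
     (\<forall>f H. continuous_map X Y f \<longrightarrow>
        continuous_map (prod_topology unit_top (subtopology X A)) Y H \<longrightarrow>
        (\<forall>x\<in>topspace X \<inter> A. H (0, x) = f x) \<longrightarrow>
        (\<exists>G. continuous_map (prod_topology unit_top X) Y G \<and>
             (\<forall>x\<in>topspace X. G (0, x) = f x) \<and>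
             (\<forall>t\<in>{0..1}. \<forall>x\<in>topspace X \<inter> A. G (t, x) = H (t, x))))"

text \<open>The abstract situation of a collapse. \<open>F\<close> deforms \<open>A\<close> into itself, from the
  identity to \<open>f\<close>, without leaving the fibres of \<open>f\<close>. The relation \<open>R\<close> identifies each fibre to a point.\<close>

locale fibre_collapse =
  fixes X :: "'a topology" and A :: "'a set" and f :: "'a \<Rightarrow> 'a"
    and F :: "real \<times> 'a \<Rightarrow> 'a" and R :: "'a \<Rightarrow> 'a \<Rightarrow> bool"
  assumes compact: "compact_space X" and Hausdorff: "Hausdorff_space X"
    and closed: "closedin X A"
    and F: "continuous_map (prod_topology unit_top (subtopology X A)) (subtopology X A) F"
    and F0: "\<And>x. x \<in> A \<Longrightarrow> F (0, x) = x"
    and F1: "\<And>x. x \<in> A \<Longrightarrow> F (1, x) = f x"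
    and fF: "\<And>t x. t \<in> {0..1} \<Longrightarrow> x \<in> A \<Longrightarrow> f (F (t, x)) = f x"
    and R: "\<And>x y. R x y \<longleftrightarrow> x = y \<or> (x \<in> A \<and> y \<in> A \<and> f x = f y)"
begin

abbreviation "\<kappa> \<equiv> quot_proj R"
abbreviation "Q \<equiv> quot_top X R"

lemma proj_eq_iff: "\<kappa> x = \<kappa> y \<longleftrightarrow> x = y \<or> (x \<in> A \<and> y \<in> A \<and> f x = f y)"
proof -
  have "equivp R"
    by (rule equivpI) (auto simp: reflp_def symp_def transp_def R)
  then show ?thesis by (simp add: quot_proj_eq_iff R)
qed

lemma A_subset: "A \<subseteq> topspace X"
  using closed by (rule closedin_subset)

lemma f_continuous: "continuous_map (subtopology X A) (subtopology X A) f"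
proof -
  have "continuous_map (subtopology X A) (prod_topology unit_top (subtopology X A)) (\<lambda>x. (1, x))"
    by (intro continuous_map_pairedI continuous_map_const[THEN iffD2] continuous_map_id[unfolded id_def]) auto
  then have "continuous_map (subtopology X A) (subtopology X A) (F \<circ> (\<lambda>x. (1, x)))"
    using F by (rule continuous_map_compose)
  then show ?thesis
    by (rule continuous_map_eq) (simp add: F1)
qed

text \<open>The saturation of a closed set \<open>C\<close> adds only those points of \<open>A\<close> that \<open>f\<close> maps into the
  image of \<open>A \<inter> C\<close>, and that image is compact. A closed projection passes normality, and thereby the
  Hausdorff property, to the quotient.\<close>

lemma proj_closed_map: "closed_map X Q \<kappa>"
  unfolding closed_map_def
proof (intro allI impI)
  fix C assume C: "closedin X C"
  have Csub: "C \<subseteq> topspace X" using C by (rule closedin_subset)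
  have cA: "compact_space (subtopology X A)"
    using closed compact by (simp add: closedin_compact_space compact_space_subtopology)
  have "closed_map (subtopology X A) (subtopology X A) f"
    using f_continuous cA Hausdorff by (simp add: continuous_imp_closed_map Hausdorff_space_subtopology)
  then have "closedin (subtopology X A) (f ` (A \<inter> C))"
    using C by (simp add: closed_map_def closedin_subtopology_Int_closed)
  then have "closedin (subtopology X A) {x \<in> topspace (subtopology X A). f x \<in> f ` (A \<inter> C)}"
    using f_continuous closedin_continuous_map_preimage by fast
  then have "closedin X {x \<in> topspace (subtopology X A). f x \<in> f ` (A \<inter> C)}"
    using closed closedin_trans_full by fast
  then have "closedin X (C \<union> {x \<in> topspace (subtopology X A). f x \<in> f ` (A \<inter> C)})"
    using C by blast
  moreover have "C \<union> {x \<in> topspace (subtopology X A). f x \<in> f ` (A \<inter> C)} = {x \<in> topspace X. \<kappa> x \<in> \<kappa> ` C}"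
    using Csub A_subset by (auto simp: proj_eq_iff image_iff Bex_def)
  moreover have "\<kappa> ` C \<subseteq> topspace Q"
    using quotient_map_quot_proj[of X R] Csub by (auto simp: quotient_map_def)
  ultimately show "closedin Q (\<kappa> ` C)"
    using quotient_map_quot_proj[of X R] by (simp add: quotient_map_closedin)
qed

lemma proj_continuous: "continuous_map X Q \<kappa>"
  by (simp add: quotient_imp_continuous_map quotient_map_quot_proj)

lemma proj_surj: "\<kappa> ` topspace X = topspace Q"
  using quotient_map_quot_proj by (rule quotient_imp_surjective_map)

lemma quotient_Hausdorff: "Hausdorff_space Q"
  using normal_Hausdorff_space_closed_continuous_map_image[OF _ Hausdorff proj_closed_map proj_continuous proj_surj]
    compact_Hausdorff_or_regular_imp_normal_space compact Hausdorff by blast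

text \<open>The extension \<open>G\<close> of \<open>F\<close> ends in a map that is constant on the classes of \<open>R\<close>. It factors as
  \<open>g \<circ> \<kappa>\<close>, and \<open>G\<close> itself is a homotopy from the identity to \<open>g \<circ> \<kappa>\<close>. On \<open>A\<close> the homotopy
  moves points within fibres, so \<open>\<kappa> \<circ> G\<close> descends to a homotopy from the identity of the quotient
  to \<open>\<kappa> \<circ> g\<close>.\<close>

lemma homotopy_equivalent_quotient:
  assumes "homotopy_extension X A X"
  shows "X homotopy_equivalent_space Q"
proof -
  have "continuous_map (prod_topology unit_top (subtopology X A)) X F"
    using F by (simp add: continuous_map_in_subtopology)
  moreover have "\<forall>x\<in>topspace X \<inter> A. F (0, x) = id x"
    by (simp add: F0)
  ultimately have "\<exists>G. continuous_map (prod_topology unit_top X) X G \<and>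
      (\<forall>x\<in>topspace X. G (0, x) = id x) \<and> (\<forall>t\<in>{0..1}. \<forall>x\<in>topspace X \<inter> A. G (t, x) = F (t, x))"
    using assms continuous_map_id unfolding homotopy_extension_def by blast
  then obtain G where G: "continuous_map (prod_topology unit_top X) X G"
    and G0': "\<forall>x\<in>topspace X. G (0, x) = id x"
    and GF': "\<forall>t\<in>{0..1}. \<forall>x\<in>topspace X \<inter> A. G (t, x) = F (t, x)"
    by (elim exE conjE)
  have G0: "G (0, x) = x" if "x \<in> topspace X" for x
    using G0' that by simp
  have GF: "G (t, x) = F (t, x)" if "t \<in> {0..1}" "x \<in> A" for t x
    using GF' A_subset that by blast
  have FA: "F (t, x) \<in> A" if "t \<in> {0..1}" "x \<in> A" for t x
    using continuous_map_image_subset_topspace[OF F] A_subset that by fastforce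
  have slice: "continuous_map X (prod_topology unit_top X) (\<lambda>x. (1, x))"
    by (intro continuous_map_pairedI continuous_map_const[THEN iffD2] continuous_map_id[unfolded id_def]) auto
  have G1: "continuous_map X X (\<lambda>x. G (1, x))"
    using continuous_map_compose[OF slice G] by (simp add: o_def)
  have resp: "G (1, x) = G (1, y)" if "x \<in> topspace X" "y \<in> topspace X" "\<kappa> x = \<kappa> y" for x y
    using that by (auto simp: proj_eq_iff GF F1)
  obtain g where g: "continuous_map Q X g" and g\<kappa>: "\<And>x. x \<in> topspace X \<Longrightarrow> g (\<kappa> x) = G (1, x)"
    by (rule quotient_map_lift_exists[OF quotient_map_quot_proj[of X R] G1]) (auto intro: resp)
  have "homotopic_with (\<lambda>_. True) X X id (g \<circ> \<kappa>)"
    using G G0 g\<kappa> by (subst homotopic_with) (auto intro!: exI[of _ G])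
  moreover have "homotopic_with (\<lambda>_. True) Q Q id (\<kappa> \<circ> g)"
  proof -
    have quot: "quotient_map (prod_topology unit_top X) (prod_topology unit_top Q) (\<lambda>(t, x). (t, \<kappa> x))"
      by (intro quotient_map_cylinder quotient_map_quot_proj)
    have \<kappa>G: "continuous_map (prod_topology unit_top X) Q (\<kappa> \<circ> G)"
      using G proj_continuous by (rule continuous_map_compose)
    have resp: "(\<kappa> \<circ> G) p = (\<kappa> \<circ> G) q"
      if "p \<in> topspace (prod_topology unit_top X)" "q \<in> topspace (prod_topology unit_top X)"
        "(\<lambda>(t, x). (t, \<kappa> x)) p = (\<lambda>(t, x). (t, \<kappa> x)) q" for p q
      using that by (auto simp: proj_eq_iff GF FA fF)
    obtain L where L: "continuous_map (prod_topology unit_top Q) Q L"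
      and L\<kappa>: "\<And>p. p \<in> topspace (prod_topology unit_top X) \<Longrightarrow> L ((\<lambda>(t, x). (t, \<kappa> x)) p) = (\<kappa> \<circ> G) p"
      by (rule quotient_map_lift_exists[OF quot \<kappa>G], erule (2) resp) (rule that; assumption)
    have L\<kappa>': "L (t, \<kappa> x) = \<kappa> (G (t, x))" if "t \<in> {0..1}" "x \<in> topspace X" for t x
      using L\<kappa>[of "(t, x)"] that by simp
    have "L (0, y) = y \<and> L (1, y) = \<kappa> (g y)" if y: "y \<in> topspace Q" for y
    proof -
      obtain x where x: "x \<in> topspace X" "y = \<kappa> x"
        using y proj_surj by auto
      then show ?thesis using L\<kappa>'[of 0 x] L\<kappa>'[of 1 x] by (simp add: G0 g\<kappa>)
    qed
    then show ?thesis
      using L by (subst homotopic_with) (auto intro!: exI[of _ L])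
  qed
  ultimately show ?thesis
    unfolding homotopy_equivalent_space_def
    using g proj_continuous homotopic_with_symD by blast
qed

end


section \<open>Attaching a cell\<close>

lemma cylinder_subtopology:
  "subtopology (prod_topology unit_top Z) ({0..1} \<times> A) = prod_topology unit_top (subtopology Z A)"
  by (simp add: subtopology_Times subtopology_subtopology)

lemma compact_ball_top: "compact_space (ball_top n)"
  by (simp add: ball_top_eq compact_space_subtopology compact_uball)

lemma quotient_map_ball_image:
  assumes "Hausdorff_space X" "continuous_map (ball_top n) X \<phi>"
  shows "quotient_map (ball_top n) (subtopology X (\<phi> ` uball n)) \<phi>"
proof (rule continuous_imp_quotient_map)
  show "continuous_map (ball_top n) (subtopology X (\<phi> ` uball n)) \<phi>"
    using assms by (auto simp: continuous_map_in_subtopology ball_top_eq)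
  show "\<phi> ` topspace (ball_top n) = topspace (subtopology X (\<phi> ` uball n))"
    using continuous_map_image_subset_topspace[OF assms(2)] by (auto simp: ball_top_eq)
qed (use assms in \<open>auto simp: compact_ball_top Hausdorff_space_subtopology\<close>)

lemma closedin_ball_image:
  assumes "Hausdorff_space X" "continuous_map (ball_top n) X \<phi>" "closedin (ball_top n) C"
  shows "closedin X (\<phi> ` C)"
  using continuous_imp_closed_map[OF assms(2) compact_ball_top assms(1)] assms(3)
  by (simp add: closed_map_def)

lemma closedin_uball: "closedin (ball_top n) (uball n)"
  using closedin_topspace[of "ball_top n"] by (simp add: ball_top_eq)

text \<open>Pulled back to the ball, the data prescribe a homotopy on the sphere. Its extension
  over the cylinder descends to the closed cell because \<open>\<phi>\<close> identifies only points of the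
  sphere, and there the extension comes from \<open>H\<close>; for the same reason it agrees with \<open>H\<close> where the
  closed cell meets \<open>A\<close>.\<close>

lemma attach_cell_extension:
  assumes X: "Hausdorff_space X" and A: "closedin X A"
    and \<phi>: "continuous_map (ball_top n) X \<phi>" and inj: "inj_on \<phi> (uball n - usphere n)"
    and int: "\<phi> ` (uball n - usphere n) \<inter> A = {}" and bdry: "\<phi> ` usphere n \<subseteq> A"
    and f: "continuous_map X Y f"
    and H: "continuous_map (prod_topology unit_top (subtopology X A)) Y H"
    and H0: "\<And>x. x \<in> A \<Longrightarrow> H (0, x) = f x"
  obtains G where "continuous_map (prod_topology unit_top (subtopology X (A \<union> \<phi> ` uball n))) Y G"
    "\<And>x. x \<in> A \<union> \<phi> ` uball n \<Longrightarrow> G (0, x) = f x"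
    "\<And>t x. t \<in> {0..1} \<Longrightarrow> x \<in> A \<Longrightarrow> G (t, x) = H (t, x)"
proof -
  let ?C = "\<phi> ` uball n"
  have sphere_iff: "x \<in> usphere n \<longleftrightarrow> \<phi> x \<in> A" if "x \<in> uball n" for x
    using that int bdry by blast
  have f\<phi>: "continuous_map (ball_top n) Y (f \<circ> \<phi>)"
    using \<phi> f by (rule continuous_map_compose)
  have "continuous_map (subtopology (ball_top n) (usphere n)) (subtopology X A) \<phi>"
    using \<phi> bdry continuous_map_from_subtopology by (fastforce simp: continuous_map_in_subtopology)
  then have "continuous_map (prod_topology unit_top (subtopology (ball_top n) (usphere n)))
      (prod_topology unit_top (subtopology X A)) (\<lambda>(t, x). (t, \<phi> x))"
    by (intro continuous_map_prod_top[where f = "\<lambda>x. x", THEN iffD2] disjI2 conjI continuous_map_id[unfolded id_def])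
  then have H\<phi>: "continuous_map (prod_topology unit_top (subtopology (ball_top n) (usphere n))) Y
      (H \<circ> (\<lambda>(t, x). (t, \<phi> x)))"
    using H by (rule continuous_map_compose)
  have "(H \<circ> (\<lambda>(t, x). (t, \<phi> x))) (0, x) = (f \<circ> \<phi>) x" if "x \<in> usphere n" for x
    using that bdry H0 by auto
  with f\<phi> H\<phi> obtain G0 where G0: "continuous_map (prod_topology unit_top (ball_top n)) Y G0"
    and G00: "\<And>x. x \<in> uball n \<Longrightarrow> G0 (0, x) = f (\<phi> x)"
    and G0H: "\<And>t x. t \<in> {0..1} \<Longrightarrow> x \<in> usphere n \<Longrightarrow> G0 (t, x) = H (t, \<phi> x)"
    by (rule ball_homotopy_extension) (auto simp: o_def)
  have quot: "quotient_map (prod_topology unit_top (ball_top n)) (prod_topology unit_top (subtopology X ?C))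
      (\<lambda>(t, x). (t, \<phi> x))"
    by (intro quotient_map_cylinder quotient_map_ball_image X \<phi>)
  have resp: "G0 p = G0 q"
    if pq: "p \<in> topspace (prod_topology unit_top (ball_top n))"
      "q \<in> topspace (prod_topology unit_top (ball_top n))"
      "(\<lambda>(t, x). (t, \<phi> x)) p = (\<lambda>(t, x). (t, \<phi> x)) q" for p q
  proof -
    obtain t x y where [simp]: "p = (t, x)" "q = (t, y)" and t: "t \<in> {0..1}"
      and xy: "x \<in> uball n" "y \<in> uball n" "\<phi> x = \<phi> y"
      using pq by (auto simp: ball_top_eq)
    show ?thesis
    proof (cases "x \<in> usphere n")
      case True
      then show ?thesis using xy t sphere_iff by (simp add: G0H)
    next
      case False
      then have "x = y" using xy sphere_iff inj by (auto simp: inj_on_def)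
      then show ?thesis by simp
    qed
  qed
  obtain G1 where G1: "continuous_map (prod_topology unit_top (subtopology X ?C)) Y G1"
    and G1\<phi>': "\<And>p. p \<in> topspace (prod_topology unit_top (ball_top n)) \<Longrightarrow> G1 ((\<lambda>(t, x). (t, \<phi> x)) p) = G0 p"
    by (rule quotient_map_lift_exists[OF quot G0], erule (2) resp) (rule that; assumption)
  have G1\<phi>: "G1 (t, \<phi> x) = G0 (t, x)" if "t \<in> {0..1}" "x \<in> uball n" for t x
    using G1\<phi>'[of "(t, x)"] that by (simp add: ball_top_eq)
  have G1H: "G1 (t, x) = H (t, x)" if "t \<in> {0..1}" "x \<in> A" "x \<in> ?C" for t x
    using that G1\<phi> G0H sphere_iff by auto
  let ?Z = "prod_topology unit_top (subtopology X (A \<union> ?C))"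
  let ?T = "\<lambda>b. {0..1} \<times> (if b then A else ?C)"
  let ?G = "\<lambda>p. if snd p \<in> A then H p else G1 p"
  have C: "closedin X ?C"
    using closedin_ball_image[OF X \<phi> closedin_uball] .
  have sub: "A \<subseteq> topspace X" "?C \<subseteq> topspace X"
    using A C closedin_subset by auto
  show thesis
  proof (rule that[of ?G])
    show "continuous_map ?Z Y ?G"
    proof (rule pasting_lemma_closed[of "UNIV :: bool set" _ ?T _ "\<lambda>b. if b then H else G1"])
      show "closedin ?Z (?T b)" for b
        using closedin_subset_topspace[OF A, of "A \<union> ?C"] closedin_subset_topspace[OF C, of "A \<union> ?C"]
        by (simp add: closedin_prod_Times_iff)
      show "continuous_map (subtopology ?Z (?T b)) Y (if b then H else G1)" for b
        using H G1 by (simp add: cylinder_subtopology subtopology_subtopology Int_absorb1 Int_absorb2)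
      show "(if b then H else G1) p = (if c then H else G1) p"
        if "p \<in> topspace ?Z \<inter> ?T b \<inter> ?T c" for b c p
      proof -
        have "fst p \<in> {0..1}" "snd p \<in> (if b then A else ?C)" "snd p \<in> (if c then A else ?C)"
          using that by (auto simp only: Int_iff mem_Times_iff)
        then show ?thesis
          using G1H[of "fst p" "snd p"] by (cases b; cases c) simp_all
      qed
      show "\<exists>b. b \<in> UNIV \<and> p \<in> ?T b \<and> ?G p = (if b then H else G1) p" if "p \<in> topspace ?Z" for p
      proof (intro exI conjI)
        show "p \<in> ?T (snd p \<in> A)"
          using that by (cases p) auto
      qed simp_all
    qed auto
    show "?G (0, x) = f x" if "x \<in> A \<union> ?C" for x
      using that H0 G1\<phi> G00 by auto
    show "?G (t, x) = H (t, x)" if "x \<in> A" for t x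
      using that by simp
  qed
qed


section \<open>The homotopy extension property of subcomplexes\<close>

locale finite_cw_complex =
  fixes K :: "'a cw"
  assumes finite_cw: "finite_cw K"
begin

abbreviation "X \<equiv> cw_space K"
abbreviation "cells \<equiv> cw_cells K"
abbreviation "cdim \<equiv> cw_dim K"
abbreviation "cchar \<equiv> cw_char K"

lemma Hausdorff: "Hausdorff_space X"
  and finite_cells: "finite cells"
  and topspace_cells: "topspace X = \<Union>cells"
  and cells_nonempty: "\<sigma> \<in> cells \<Longrightarrow> \<sigma> \<noteq> {}"
  using finite_cw by (auto simp: finite_cw_def partition_on_def)

lemma cells_disjoint: "\<sigma> \<in> cells \<Longrightarrow> \<tau> \<in> cells \<Longrightarrow> x \<in> \<sigma> \<Longrightarrow> x \<in> \<tau> \<Longrightarrow> \<sigma> = \<tau>"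
  using finite_cw unfolding finite_cw_def partition_on_def disjoint_def by blast

lemma char_continuous: "\<sigma> \<in> cells \<Longrightarrow> continuous_map (ball_top (cdim \<sigma>)) X (cchar \<sigma>)"
  using finite_cw by (simp add: finite_cw_def)

lemma char_boundary: "\<sigma> \<in> cells \<Longrightarrow> cchar \<sigma> ` usphere (cdim \<sigma>) \<subseteq> \<Union>{\<tau> \<in> cells. cdim \<tau> < cdim \<sigma>}"
  using finite_cw unfolding finite_cw_def by blast

lemma char_homeomorphic: "\<sigma> \<in> cells \<Longrightarrow>
    homeomorphic_map (subtopology (Euclidean_space (cdim \<sigma>)) (uball (cdim \<sigma>) - usphere (cdim \<sigma>)))
      (subtopology X \<sigma>) (cchar \<sigma>)"
  using finite_cw unfolding finite_cw_def by blast

lemma char_interior: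
  assumes "\<sigma> \<in> cells"
  shows "cchar \<sigma> ` (uball (cdim \<sigma>) - usphere (cdim \<sigma>)) = \<sigma>"
proof -
  have "\<sigma> \<subseteq> topspace X" using assms topspace_cells by auto
  then show ?thesis
    using homeomorphic_imp_surjective_map[OF char_homeomorphic[OF assms]]
    by (simp add: subtopology_Euclidean_space_eq Int_absorb1)
qed

lemma char_inj: "\<sigma> \<in> cells \<Longrightarrow> inj_on (cchar \<sigma>) (uball (cdim \<sigma>) - usphere (cdim \<sigma>))"
  using homeomorphic_imp_injective_map[OF char_homeomorphic]
  by (simp add: subtopology_Euclidean_space_eq)

lemma char_sphere_lower:
  assumes "\<sigma> \<in> cells" "y \<in> usphere (cdim \<sigma>)" "\<tau> \<in> cells" "cchar \<sigma> y \<in> \<tau>"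
  shows "cdim \<tau> < cdim \<sigma>"
proof -
  obtain \<rho> where "\<rho> \<in> cells" "cdim \<rho> < cdim \<sigma>" "cchar \<sigma> y \<in> \<rho>"
    using char_boundary[OF assms(1)] assms(2) by blast
  then show ?thesis using cells_disjoint assms by blast
qed

lemma char_in_cell_iff:
  assumes "\<sigma> \<in> cells" "y \<in> uball (cdim \<sigma>)"
  shows "cchar \<sigma> y \<in> \<sigma> \<longleftrightarrow> y \<notin> usphere (cdim \<sigma>)"
  using char_sphere_lower[OF assms(1) _ assms(1)] char_interior[OF assms(1)] assms(2) by blast

lemma closed_char_image: "\<sigma> \<in> cells \<Longrightarrow> closedin X (cchar \<sigma> ` uball (cdim \<sigma>))"
  by (rule closedin_ball_image[OF Hausdorff char_continuous closedin_uball])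

lemma closure_of_cell:
  assumes "\<sigma> \<in> cells"
  shows "X closure_of \<sigma> = cchar \<sigma> ` uball (cdim \<sigma>)"
proof
  have "\<sigma> \<subseteq> cchar \<sigma> ` uball (cdim \<sigma>)"
    using char_interior[OF assms] by blast
  then show "X closure_of \<sigma> \<subseteq> cchar \<sigma> ` uball (cdim \<sigma>)"
    by (rule closure_of_minimal) (rule closed_char_image[OF assms])
  have "cchar \<sigma> ` (ball_top (cdim \<sigma>) closure_of (uball (cdim \<sigma>) - usphere (cdim \<sigma>))) \<subseteq> X closure_of \<sigma>"
    using continuous_map_image_closure_subset[OF char_continuous[OF assms]] char_interior[OF assms] by metis
  then show "cchar \<sigma> ` uball (cdim \<sigma>) \<subseteq> X closure_of \<sigma>"
    using open_ball_dense by blast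
qed

text \<open>The dimension bound behind all incidence arguments: the boundary of a cell only meets cells
  of lower dimension.\<close>

lemma closure_of_cell_cases:
  assumes "\<sigma> \<in> cells" "\<tau> \<in> cells" "x \<in> \<tau>" "x \<in> X closure_of \<sigma>"
  shows "\<tau> = \<sigma> \<or> cdim \<tau> < cdim \<sigma>"
proof -
  obtain y where y: "y \<in> uball (cdim \<sigma>)" "x = cchar \<sigma> y"
    using assms closure_of_cell by auto
  show ?thesis
  proof (cases "y \<in> usphere (cdim \<sigma>)")
    case True
    then show ?thesis using char_sphere_lower assms y by blast
  next
    case False
    then show ?thesis using char_in_cell_iff cells_disjoint assms y by blast
  qed
qed

lemma compact_X: "compact_space X"
proof -
  have "compactin X (\<Union>\<sigma>\<in>cells. cchar \<sigma> ` uball (cdim \<sigma>))"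
    using finite_cells
  proof (intro compactin_Union, goal_cases)
    case (2 S)
    then obtain \<sigma> where "\<sigma> \<in> cells" "S = cchar \<sigma> ` topspace (ball_top (cdim \<sigma>))"
      by (auto simp: ball_top_eq)
    then show ?case
      using image_compactin[OF _ char_continuous] compact_ball_top by (metis compact_space_def)
  qed simp
  moreover have "(\<Union>\<sigma>\<in>cells. cchar \<sigma> ` uball (cdim \<sigma>)) = topspace X"
  proof
    show "(\<Union>\<sigma>\<in>cells. cchar \<sigma> ` uball (cdim \<sigma>)) \<subseteq> topspace X"
      using closed_char_image closedin_subset by blast
    show "topspace X \<subseteq> (\<Union>\<sigma>\<in>cells. cchar \<sigma> ` uball (cdim \<sigma>))"
      unfolding topspace_cells using char_interior by blast
  qed
  ultimately show ?thesis by (simp add: compact_space_def)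
qed

text \<open>The missing cells are attached one by one. A missing cell of least dimension has its boundary
  in the part already covered, so it can be attached next.\<close>

lemma subcomplex_homotopy_extension:
  assumes "S \<subseteq> cells" "closedin X (\<Union>S)"
  shows "homotopy_extension X (\<Union>S) Y"
  using assms
proof (induction "card (cells - S)" arbitrary: S rule: less_induct)
  case less
  show ?case
  proof (cases "S = cells")
    case True
    then have top: "\<Union>S = topspace X" by (simp add: topspace_cells)
    show ?thesis
      unfolding homotopy_extension_def top by (auto intro!: exI)
  next
    case False
    then obtain \<rho> where "\<rho> \<in> cells - S" using less.prems by blast
    from ex_has_least_nat[of "\<lambda>\<sigma>. \<sigma> \<in> cells - S", OF this, of cdim]
    obtain \<sigma> where \<sigma>': "\<sigma> \<in> cells - S" and min: "\<forall>\<tau>. \<tau> \<in> cells - S \<longrightarrow> cdim \<sigma> \<le> cdim \<tau>"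
      by (elim exE conjE)
    from \<sigma>' have \<sigma>: "\<sigma> \<in> cells" "\<sigma> \<notin> S" by blast+
    let ?n = "cdim \<sigma>"
    have bdry: "cchar \<sigma> ` usphere ?n \<subseteq> \<Union>S"
    proof -
      have "\<tau> \<in> S" if "\<tau> \<in> cells" "cdim \<tau> < ?n" for \<tau>
        using that min[rule_format, of \<tau>] by (metis DiffI not_le)
      then have "\<Union>{\<tau> \<in> cells. cdim \<tau> < ?n} \<subseteq> \<Union>S"
        by (intro Union_mono) auto
      with char_boundary[OF \<sigma>(1)] show ?thesis
        by (rule subset_trans)
    qed
    have int: "cchar \<sigma> ` (uball ?n - usphere ?n) \<inter> \<Union>S = {}"
      unfolding char_interior[OF \<sigma>(1)] using \<sigma> cells_disjoint less.prems(1) by blast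
    have un: "\<Union>(insert \<sigma> S) = \<Union>S \<union> cchar \<sigma> ` uball ?n"
      using char_interior[OF \<sigma>(1)] bdry usphere_subset_uball[of ?n] by blast
    have "closedin X (\<Union>(insert \<sigma> S))"
      unfolding un using less.prems closed_char_image[OF \<sigma>(1)] by blast
    moreover have "card (cells - insert \<sigma> S) < card (cells - S)"
      using \<sigma> finite_cells by (intro psubset_card_mono) auto
    moreover have "insert \<sigma> S \<subseteq> cells"
      using less.prems \<sigma> by blast
    ultimately have IH: "homotopy_extension X (\<Union>(insert \<sigma> S)) Y"
      by (intro less.hyps)
    have sub: "\<Union>(insert \<sigma> S) \<subseteq> topspace X" "\<Union>S \<subseteq> topspace X"
      using less.prems \<sigma> topspace_cells by auto
    show ?thesis
      unfolding homotopy_extension_def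
    proof (intro allI impI)
      fix f H
      assume f: "continuous_map X Y f"
        and H: "continuous_map (prod_topology unit_top (subtopology X (\<Union>S))) Y H"
        and "\<forall>x\<in>topspace X \<inter> \<Union>S. H (0, x) = f x"
      then have H0: "H (0, x) = f x" if "x \<in> \<Union>S" for x
        using sub that by blast
      obtain G1 where G1: "continuous_map (prod_topology unit_top (subtopology X (\<Union>(insert \<sigma> S)))) Y G1"
        "\<And>x. x \<in> \<Union>(insert \<sigma> S) \<Longrightarrow> G1 (0, x) = f x"
        "\<And>t x. t \<in> {0..1} \<Longrightarrow> x \<in> \<Union>S \<Longrightarrow> G1 (t, x) = H (t, x)"
        using attach_cell_extension[OF Hausdorff less.prems(2) char_continuous[OF \<sigma>(1)]
              char_inj[OF \<sigma>(1)] int bdry f H H0, folded un] by metis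
      have "\<forall>x\<in>topspace X \<inter> \<Union>(insert \<sigma> S). G1 (0, x) = f x"
        using G1(2) by blast
      with IH f G1(1) obtain G where "continuous_map (prod_topology unit_top X) Y G"
        "\<forall>x\<in>topspace X. G (0, x) = f x"
        "\<forall>t\<in>{0..1}. \<forall>x\<in>topspace X \<inter> \<Union>(insert \<sigma> S). G (t, x) = G1 (t, x)"
        unfolding homotopy_extension_def by blast
      then show "\<exists>G. continuous_map (prod_topology unit_top X) Y G \<and>
             (\<forall>x\<in>topspace X. G (0, x) = f x) \<and>
             (\<forall>t\<in>{0..1}. \<forall>x\<in>topspace X \<inter> \<Union>S. G (t, x) = H (t, x))"
        using G1(3) by (intro exI[of _ G]) auto
    qed
  qed
qed

end


section \<open>Homeomorphisms of balls and hemispheres\<close>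

lemma openin_open_ball: "openin (Euclidean_space n) (uball n - usphere n)"
proof -
  have "open {x :: nat \<Rightarrow> real. radius n x < 1}"
    by (rule open_Collect_less[OF continuous_on_radius[OF continuous_on_id] continuous_on_const])
  moreover have "uball n - usphere n = {x. \<forall>i\<ge>n. x i = 0} \<inter> {x. radius n x < 1}"
    by (auto simp: in_uball_iff in_usphere_iff)
  ultimately show ?thesis
    unfolding Euclidean_space_eq openin_open by blast
qed

text \<open>Neither the map nor its inverse can take an interior point to the sphere, by invariance of
  domain.\<close>

lemma ball_homeomorphism_sphere_iff:
  assumes g: "homeomorphic_map (ball_top n) (ball_top n) g" and x: "x \<in> uball n"
  shows "g x \<in> usphere n \<longleftrightarrow> x \<in> usphere n"
proof -
  have *: "g x \<notin> usphere n"
    if g: "homeomorphic_map (ball_top n) (ball_top n) g" and x: "x \<in> uball n - usphere n" for g x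
  proof -
    have "continuous_map (ball_top n) (ball_top n) g"
      using g by (rule homeomorphic_imp_continuous_map)
    then have "continuous_map (subtopology (ball_top n) (uball n - usphere n)) (Euclidean_space n) g"
      by (rule continuous_map_into_fulltopology[OF continuous_map_from_subtopology])
    then have "continuous_map (subtopology (Euclidean_space n) (uball n - usphere n)) (Euclidean_space n) g"
      by (simp add: subtopology_subtopology Int_absorb1)
    moreover have "inj_on g (uball n)" "g ` uball n = uball n"
      using homeomorphic_imp_injective_map[OF g] homeomorphic_imp_surjective_map[OF g]
      by (simp_all add: ball_top_eq)
    ultimately have "g ` (uball n - usphere n) \<inter> usphere n = {}"
      by (intro injective_into_ball_avoids_sphere openin_open_ball) (auto intro: inj_on_subset)
    then show ?thesis using x by blast
  qed
  obtain k where k: "homeomorphic_maps (ball_top n) (ball_top n) g k"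
    using g homeomorphic_map_maps by blast
  have "g x \<in> uball n" "k (g x) = x"
    using k x homeomorphic_imp_surjective_map[OF g]
    by (auto simp: homeomorphic_maps_def ball_top_eq)
  moreover have "homeomorphic_map (ball_top n) (ball_top n) k"
    using k homeomorphic_maps_map by blast
  ultimately show ?thesis
    using *[OF g, of x] *[of k "g x"] x by auto
qed

lemma hemispheres_union: "usphere n = hemi_minus n \<union> hemi_plus n"
  by (auto simp: hemi_minus_def hemi_plus_def)

text \<open>The open lower hemisphere is a graph over the open ball of dimension \<open>m\<close>. With \<open>e\<close> the
  parametrisation by this graph, \<open>h \<circ> e\<close> is an injective continuous map from an open subset of
  Euclidean \<open>m\<close>-space into the ball; hence it avoids the sphere.\<close>

lemma hemi_minus_homeomorphism_interior:
  assumes h: "homeomorphic_map (subtopology (Euclidean_space (Suc m)) (hemi_minus (Suc m))) (ball_top m) h"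
    and y: "y \<in> hemi_minus (Suc m)" "y \<notin> hemi_plus (Suc m)"
  shows "h y \<in> uball m - usphere m"
proof -
  let ?U = "uball m - usphere m"
  let ?e = "\<lambda>x i. if i < Suc m then (if i < m then x i else - sqrt (1 - (radius m x)\<^sup>2)) else 0"
  have hemi: "hemi_minus (Suc m) \<subseteq> uball (Suc m)"
    using usphere_subset_uball by (auto simp: hemi_minus_def)
  have rad: "(radius (Suc m) x)\<^sup>2 = (radius m x)\<^sup>2 + (x m)\<^sup>2" for x
    by (simp add: radius_def sum_nonneg)
  have e_in: "?e x \<in> hemi_minus (Suc m)" if "x \<in> ?U" for x
  proof -
    have le: "(radius m x)\<^sup>2 \<le> 1"
      using that radius_nonneg by (simp add: in_uball_iff power_le_one)
    have "radius m (?e x) = radius m x"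
      by (simp add: radius_def)
    then have "(radius (Suc m) (?e x))\<^sup>2 = 1"
      unfolding rad using le by simp
    then have "radius (Suc m) (?e x) = 1"
      using radius_nonneg by (metis abs_of_nonneg power2_eq_1_iff abs_1 abs_minus)
    then show ?thesis
      using le by (simp add: hemi_minus_def in_usphere_iff)
  qed
  have cont_e: "continuous_map (subtopology (Euclidean_space m) ?U) (Euclidean_space (Suc m)) ?e"
    unfolding continuous_map_componentwise_Euclidean_space
  proof (intro allI impI)
    fix i assume "i < Suc m"
    have "continuous_on ?U (\<lambda>x. x i)"
      by (rule continuous_on_product_then_coordinatewise[OF continuous_on_id])
    moreover have "continuous_on ?U (\<lambda>x. - sqrt (1 - (radius m x)\<^sup>2))"
      by (intro continuous_on_minus continuous_on_real_sqrt continuous_on_diff continuous_on_power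
          continuous_on_radius continuous_on_const continuous_on_id)
    ultimately have "continuous_on ?U (\<lambda>x. if i < m then x i else - sqrt (1 - (radius m x)\<^sup>2))"
      by (cases "i < m") simp_all
    then show "continuous_map (subtopology (Euclidean_space m) ?U) euclideanreal
        (\<lambda>x. if i < m then x i else - sqrt (1 - (radius m x)\<^sup>2))"
      unfolding subtopology_Euclidean_space_eq[OF Diff_subset] continuous_map_iff_continuous .
  qed
  then have "continuous_map (subtopology (Euclidean_space m) ?U)
      (subtopology (Euclidean_space (Suc m)) (hemi_minus (Suc m))) ?e"
    using e_in by (auto simp: continuous_map_in_subtopology)
  then have "continuous_map (subtopology (Euclidean_space m) ?U) (ball_top m) (h \<circ> ?e)"
    using homeomorphic_imp_continuous_map[OF h] by (rule continuous_map_compose)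
  then have cont: "continuous_map (subtopology (Euclidean_space m) ?U) (Euclidean_space m) (h \<circ> ?e)"
    by (rule continuous_map_into_fulltopology)
  have inj_h: "inj_on h (hemi_minus (Suc m))" and surj_h: "h ` hemi_minus (Suc m) = uball m"
    using homeomorphic_imp_injective_map[OF h] homeomorphic_imp_surjective_map[OF h]
    by (simp_all add: subtopology_Euclidean_space_eq hemi)
  have "inj_on ?e ?U"
  proof (rule inj_onI, rule ext)
    fix x x' i assume xs: "x \<in> ?U" "x' \<in> ?U" "?e x = ?e x'"
    show "x i = x' i"
    proof (cases "i < m")
      case True
      then show ?thesis using fun_cong[OF xs(3), of i] by simp
    next
      case False
      then show ?thesis using xs by (simp add: in_uball_iff)
    qed
  qed
  then have inj: "inj_on (h \<circ> ?e) ?U"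
    using inj_h e_in by (intro comp_inj_on) (auto intro: inj_on_subset)
  have "(h \<circ> ?e) ` ?U \<subseteq> uball m"
    using surj_h e_in by auto
  with openin_open_ball cont inj have avoid: "(h \<circ> ?e) ` ?U \<inter> usphere m = {}"
    by (rule injective_into_ball_avoids_sphere)
  let ?x = "\<lambda>i. if i < m then y i else 0"
  have ym: "y m < 0" and y1: "radius (Suc m) y = 1" and y0: "\<And>i. i \<ge> Suc m \<Longrightarrow> y i = 0"
    using y by (auto simp: hemi_minus_def hemi_plus_def in_usphere_iff)
  have rx: "radius m ?x = radius m y"
    by (simp add: radius_def)
  have sq: "(radius m y)\<^sup>2 + (y m)\<^sup>2 = 1"
    using rad[of y] y1 by simp
  then have "(radius m y)\<^sup>2 < 1\<^sup>2"
    using ym by (smt (verit) one_power2 zero_less_power2)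
  then have "radius m y < 1"
    using power2_less_imp_less zero_le_one by blast
  then have "?x \<in> ?U"
    by (simp add: in_uball_iff in_usphere_iff rx)
  moreover have "?e ?x = y"
  proof
    fix i
    have "sqrt (1 - (radius m y)\<^sup>2) = \<bar>y m\<bar>"
      using sq by (metis add_diff_cancel_left' real_sqrt_abs)
    then show "?e ?x i = y i"
      unfolding rx using ym y0[of i] by (auto simp: less_Suc_eq)
  qed
  ultimately have "h y \<notin> usphere m"
    using avoid by fastforce
  then show ?thesis using y surj_h by blast
qed


section \<open>The geometry of a reduction pair\<close>

locale adapted_pair = finite_cw_complex K
  for K :: "'a cw" +
  fixes \<alpha>0 \<alpha>1 :: "'a set" and chi :: "nat \<Rightarrow> (nat \<Rightarrow> real) \<Rightarrow> (nat \<Rightarrow> real) \<times> real"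
  assumes facet: "facet K \<alpha>0 \<alpha>1"
    and adapted: "adapted_char K \<alpha>0 \<alpha>1 (cw_char K \<alpha>1)"
    and chi: "cylinder_homeo (cw_dim K \<alpha>1) (chi (cw_dim K \<alpha>1))"
begin

abbreviation "n \<equiv> cw_dim K \<alpha>1"
abbreviation "\<phi> \<equiv> cw_char K \<alpha>1"
abbreviation "cyl \<equiv> chi n"
abbreviation "Kplus \<equiv> \<phi> ` hemi_plus n"
abbreviation "f \<equiv> collapse_fun chi K (\<alpha>0, \<alpha>1)"

lemma \<alpha>_cells: "\<alpha>0 \<in> cells" "\<alpha>1 \<in> cells" and dim_\<alpha>1: "n = Suc (cdim \<alpha>0)"
  using facet by (auto simp: facet_def)

lemma hemi_subset: "hemi_plus n \<subseteq> uball n" "hemi_minus n \<subseteq> uball n"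
  using usphere_subset_uball by (auto simp: hemi_plus_def hemi_minus_def)

lemma hemi_homeo:
  obtains h where "\<And>y. y \<in> hemi_minus n \<Longrightarrow> \<phi> y = cchar \<alpha>0 (h y)"
    "inj_on h (hemi_minus n)" "h ` hemi_minus n = uball (cdim \<alpha>0)"
    "\<And>y. y \<in> hemi_minus n \<Longrightarrow> y \<notin> hemi_plus n \<Longrightarrow> h y \<in> uball (cdim \<alpha>0) - usphere (cdim \<alpha>0)"
proof -
  obtain h where h: "homeomorphic_map (subtopology (Euclidean_space n) (hemi_minus n)) (ball_top (cdim \<alpha>0)) h"
    and eq: "\<forall>y\<in>hemi_minus n. \<phi> y = cchar \<alpha>0 (h y)"
    using adapted dim_\<alpha>1 by (auto simp: adapted_char_def Let_def)
  show ?thesis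
  proof (rule that[of h])
    show "inj_on h (hemi_minus n)" "h ` hemi_minus n = uball (cdim \<alpha>0)"
      using homeomorphic_imp_injective_map[OF h] homeomorphic_imp_surjective_map[OF h] hemi_subset
      by (simp_all add: subtopology_Euclidean_space_eq)
    show "h y \<in> uball (cdim \<alpha>0) - usphere (cdim \<alpha>0)" if "y \<in> hemi_minus n" "y \<notin> hemi_plus n" for y
      using hemi_minus_homeomorphism_interior h that unfolding dim_\<alpha>1 by blast
  qed (use eq in blast)
qed

lemma \<phi>_hemi_plus: "y \<in> hemi_plus n \<Longrightarrow> \<phi> y \<notin> \<alpha>0 \<union> \<alpha>1"
proof -
  assume y: "y \<in> hemi_plus n"
  then have "\<phi> y \<notin> \<alpha>0"
    using adapted by (auto simp: adapted_char_def Let_def)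
  moreover have "\<phi> y \<notin> \<alpha>1"
    using y hemi_subset char_in_cell_iff[OF \<alpha>_cells(2)] by (auto simp: hemi_plus_def)
  ultimately show ?thesis by simp
qed

lemma \<phi>_hemi_minus: "y \<in> hemi_minus n \<Longrightarrow> y \<notin> hemi_plus n \<Longrightarrow> \<phi> y \<in> \<alpha>0"
  by (rule hemi_homeo) (use char_interior[OF \<alpha>_cells(1)] in auto)

lemma \<phi>_cases:
  assumes "y \<in> uball n" "y \<notin> hemi_plus n"
  shows "y \<in> uball n - usphere n \<and> \<phi> y \<in> \<alpha>1 \<or> y \<in> hemi_minus n \<and> \<phi> y \<in> \<alpha>0"
  using assms char_in_cell_iff[OF \<alpha>_cells(2)] \<phi>_hemi_minus hemispheres_union by blast

lemma \<alpha>_distinct: "x \<in> \<alpha>0 \<Longrightarrow> x \<notin> \<alpha>1" "\<alpha>0 \<noteq> \<alpha>1"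
proof -
  show "\<alpha>0 \<noteq> \<alpha>1"
    using dim_\<alpha>1 by auto
  then show "x \<notin> \<alpha>1" if "x \<in> \<alpha>0"
    using that cells_disjoint[OF \<alpha>_cells, of x] by blast
qed

lemma \<phi>_inj: "inj_on \<phi> (uball n - hemi_plus n)"
proof (rule inj_onI)
  fix y z assume y: "y \<in> uball n - hemi_plus n" and z: "z \<in> uball n - hemi_plus n" and eq: "\<phi> y = \<phi> z"
  from y z eq \<alpha>_distinct(1) \<phi>_cases
  consider "y \<in> uball n - usphere n" "z \<in> uball n - usphere n" | "y \<in> hemi_minus n" "z \<in> hemi_minus n"
    by (metis DiffD1 DiffD2)
  then show "y = z"
  proof cases
    case 1
    then show ?thesis using char_inj[OF \<alpha>_cells(2)] eq by (auto simp: inj_on_def)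
  next
    case 2
    show ?thesis
    proof (rule hemi_homeo)
      fix h assume h: "inj_on h (hemi_minus n)" "\<And>y. y \<in> hemi_minus n \<Longrightarrow> \<phi> y = cchar \<alpha>0 (h y)"
        "\<And>y. y \<in> hemi_minus n \<Longrightarrow> y \<notin> hemi_plus n \<Longrightarrow> h y \<in> uball (cdim \<alpha>0) - usphere (cdim \<alpha>0)"
      have "h y = h z"
        using char_inj[OF \<alpha>_cells(1)] h(2,3) 2 y z eq by (metis DiffD2 inj_onD)
      then show "y = z" using h(1) 2 by (auto simp: inj_on_def)
    qed
  qed
qed

text \<open>This makes \<open>inv_into (uball n) \<phi>\<close>, which occurs in the definition of \<open>collapse_fun\<close>, a true
  inverse of \<open>\<phi>\<close> off the upper hemisphere.\<close>

lemma \<phi>_preimage: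
  assumes "y \<in> uball n" "y \<notin> hemi_plus n" "z \<in> uball n" "\<phi> z = \<phi> y"
  shows "z = y"
  using assms \<phi>_inj \<phi>_cases[of y] \<phi>_hemi_plus[of z] by (metis DiffI Un_iff inj_onD)

lemma \<alpha>0_image: "\<alpha>0 \<subseteq> \<phi> ` hemi_minus n"
proof (rule hemi_homeo)
  fix h assume h: "\<And>y. y \<in> hemi_minus n \<Longrightarrow> \<phi> y = cchar \<alpha>0 (h y)" "h ` hemi_minus n = uball (cdim \<alpha>0)"
  have "\<alpha>0 \<subseteq> cchar \<alpha>0 ` (h ` hemi_minus n)"
    using char_interior[OF \<alpha>_cells(1)] h(2) by blast
  then show ?thesis using h(1) by force
qed

lemma \<phi>_sphere: "\<phi> ` usphere n = \<alpha>0 \<union> Kplus"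
proof -
  have "\<alpha>0 \<subseteq> \<phi> ` usphere n"
    using \<alpha>0_image hemispheres_union by blast
  moreover have "\<phi> y \<in> \<alpha>0 \<union> Kplus" if "y \<in> usphere n" for y
    using that hemispheres_union \<phi>_hemi_minus by blast
  ultimately show ?thesis
    using hemispheres_union by blast
qed

lemma closure_\<alpha>1: "X closure_of \<alpha>1 = \<alpha>0 \<union> \<alpha>1 \<union> Kplus" "X closure_of \<alpha>1 = \<phi> ` uball n"
proof -
  show *: "X closure_of \<alpha>1 = \<phi> ` uball n"
    by (rule closure_of_cell[OF \<alpha>_cells(2)])
  have "uball n = (uball n - usphere n) \<union> usphere n"
    using usphere_subset_uball by blast
  then have "\<phi> ` uball n = \<alpha>1 \<union> \<phi> ` usphere n"
    using char_interior[OF \<alpha>_cells(2)] by (metis image_Un)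
  then show "X closure_of \<alpha>1 = \<alpha>0 \<union> \<alpha>1 \<union> Kplus"
    unfolding * \<phi>_sphere by blast
qed

text \<open>The image of the sphere is a subcomplex, and \<open>Kplus\<close> is that image without the cell \<open>\<alpha>0\<close>.\<close>

lemma Kplus_cells:
  obtains S where "S \<subseteq> cells" "\<alpha>0 \<notin> S" "\<alpha>1 \<notin> S" "Kplus = \<Union>S" "\<And>\<sigma>. \<sigma> \<in> S \<Longrightarrow> cdim \<sigma> < n"
proof -
  obtain T where T: "T \<subseteq> cells" "\<phi> ` usphere n = \<Union>T"
    using adapted by (auto simp: adapted_char_def Let_def subcomplex_def)
  have disj: "Kplus \<inter> (\<alpha>0 \<union> \<alpha>1) = {}"
    using \<phi>_hemi_plus by blast
  have low: "cdim \<sigma> < n" if "\<sigma> \<in> T" for \<sigma>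
  proof -
    have \<sigma>: "\<sigma> \<in> cells" using T(1) that by blast
    then obtain x where x: "x \<in> \<sigma>" using cells_nonempty by blast
    then have "x \<in> \<phi> ` usphere n" unfolding T(2) using that by blast
    then obtain y where "y \<in> usphere n" "x = \<phi> y" by blast
    then show ?thesis
      using char_sphere_lower[OF \<alpha>_cells(2) _ \<sigma>] x by simp
  qed
  have "\<sigma> \<inter> \<alpha>0 = {}" if "\<sigma> \<in> T - {\<alpha>0}" for \<sigma>
    using that T(1) cells_disjoint \<alpha>_cells by blast
  then have "\<Union>(T - {\<alpha>0}) = \<Union>T - \<alpha>0"
    by blast
  also have "\<dots> = Kplus"
    unfolding T(2)[symmetric] \<phi>_sphere using disj by blast
  finally have eq: "\<Union>(T - {\<alpha>0}) = Kplus" .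
  show ?thesis
  proof (rule that[of "T - {\<alpha>0}"])
    show "\<alpha>1 \<notin> T - {\<alpha>0}"
      using low by blast
  qed (use T(1) low eq in auto)
qed

lemma cell_meets_Kplus:
  assumes "\<sigma> \<in> cells" "x \<in> \<sigma>" "x \<in> Kplus"
  shows "cdim \<sigma> < n" "\<sigma> \<noteq> \<alpha>0" "\<sigma> \<noteq> \<alpha>1"
  by (rule Kplus_cells; use assms cells_disjoint in blast)+

lemma closure_\<alpha>1_subcomplex:
  obtains S where "S \<subseteq> cells" "X closure_of \<alpha>1 = \<Union>S"
proof (rule Kplus_cells)
  fix S assume "S \<subseteq> cells" "Kplus = \<Union>S"
  then show ?thesis
    using \<alpha>_cells by (intro that[of "insert \<alpha>0 (insert \<alpha>1 S)"]) (auto simp: closure_\<alpha>1(1))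
qed

text \<open>At time \<open>s\<close> the height in the cylinder has shrunk by the factor \<open>1 - s\<close>. The upper
  hemisphere is the bottom of the cylinder and stays fixed.\<close>

definition squash :: "real \<Rightarrow> (nat \<Rightarrow> real) \<Rightarrow> nat \<Rightarrow> real" where
  "squash s y = inv_into (uball n) cyl (fst (cyl y), (1 - s) * snd (cyl y))"

lemma chi_homeo: "homeomorphic_map (ball_top n) (prod_topology (ball_top (n - 1)) unit_top) cyl"
  using chi by (simp add: cylinder_homeo_def)

lemma chi_bij: "inj_on cyl (uball n)" "cyl ` uball n = uball (n - 1) \<times> {0..1}"
  using homeomorphic_imp_injective_map[OF chi_homeo] homeomorphic_imp_surjective_map[OF chi_homeo]
  by (simp_all add: ball_top_eq)

lemma chi_inv:
  "p \<in> uball (n - 1) \<times> {0..1} \<Longrightarrow> inv_into (uball n) cyl p \<in> uball n"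
  "p \<in> uball (n - 1) \<times> {0..1} \<Longrightarrow> cyl (inv_into (uball n) cyl p) = p"
  "y \<in> uball n \<Longrightarrow> inv_into (uball n) cyl (cyl y) = y"
  using inv_into_into[of p cyl "uball n"] f_inv_into_f[of p cyl "uball n"] inv_into_f_f[OF chi_bij(1), of y]
  by (simp_all add: chi_bij(2))

lemma hemi_plus_iff: "y \<in> uball n \<Longrightarrow> y \<in> hemi_plus n \<longleftrightarrow> snd (cyl y) = 0"
proof -
  assume y: "y \<in> uball n"
  have im: "cyl ` hemi_plus n = uball (n - 1) \<times> {0}"
    using chi by (simp add: cylinder_homeo_def)
  have "y \<in> hemi_plus n \<longleftrightarrow> cyl y \<in> cyl ` hemi_plus n"
    using inj_on_image_mem_iff[OF chi_bij(1) y hemi_subset(1)] by simp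
  also have "\<dots> \<longleftrightarrow> snd (cyl y) = 0"
  proof -
    have "cyl y \<in> uball (n - 1) \<times> {0..1}"
      using y chi_bij(2) by blast
    then show ?thesis
      unfolding im by (auto simp: mem_Times_iff)
  qed
  finally show ?thesis .
qed

lemma chi_squash:
  assumes "s \<in> {0..1}" "y \<in> uball n"
  shows "squash s y \<in> uball n" "cyl (squash s y) = (fst (cyl y), (1 - s) * snd (cyl y))"
proof -
  have "cyl y \<in> uball (n - 1) \<times> {0..1}"
    using assms chi_bij by blast
  then have "(fst (cyl y), (1 - s) * snd (cyl y)) \<in> uball (n - 1) \<times> {0..1}"
    using assms(1) by (auto simp: mem_Times_iff mult_le_one)
  then show "squash s y \<in> uball n" "cyl (squash s y) = (fst (cyl y), (1 - s) * snd (cyl y))"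
    unfolding squash_def using chi_inv by auto
qed

lemma squash_0: "y \<in> uball n \<Longrightarrow> squash 0 y = y"
  by (simp add: squash_def chi_inv)

lemma squash_hemi_plus: "y \<in> hemi_plus n \<Longrightarrow> squash s y = y"
proof -
  assume y: "y \<in> hemi_plus n"
  then have yb: "y \<in> uball n" using hemi_subset by blast
  then have "(fst (cyl y), (1 - s) * snd (cyl y)) = cyl y"
    using hemi_plus_iff y by (simp add: prod_eq_iff)
  then show ?thesis by (simp add: squash_def chi_inv yb)
qed

lemma squash_1: "y \<in> uball n \<Longrightarrow> squash 1 y \<in> hemi_plus n"
  using chi_squash[of 1 y] hemi_plus_iff by simp

lemma squash_squash: "s \<in> {0..1} \<Longrightarrow> y \<in> uball n \<Longrightarrow> squash 1 (squash s y) = squash 1 y"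
  using chi_squash[of s y] by (simp add: squash_def)

lemma continuous_squash:
  "continuous_map (prod_topology unit_top (ball_top n)) (ball_top n) (\<lambda>(s, y). squash s y)"
proof -
  let ?B = "prod_topology unit_top (ball_top n)" and ?C = "prod_topology (ball_top (n - 1)) unit_top"
  obtain \<psi> where \<psi>: "homeomorphic_maps (ball_top n) ?C cyl \<psi>"
    using chi_homeo homeomorphic_map_maps by blast
  have ccyl: "continuous_map ?B ?C (\<lambda>p. cyl (snd p))"
    using continuous_map_compose[OF continuous_map_snd homeomorphic_imp_continuous_map[OF chi_homeo]]
    by (simp add: o_def)
  have c1: "continuous_map ?B (ball_top (n - 1)) (\<lambda>p. fst (cyl (snd p)))"
    using continuous_map_compose[OF ccyl continuous_map_fst] by (simp add: o_def)
  have c2: "continuous_map ?B euclideanreal (\<lambda>p. snd (cyl (snd p)))"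
    using continuous_map_into_fulltopology[OF continuous_map_compose[OF ccyl continuous_map_snd]]
    by (simp add: o_def)
  have c3: "continuous_map ?B euclideanreal fst"
    by (rule continuous_map_into_fulltopology[OF continuous_map_fst])
  have "continuous_map ?B euclideanreal (\<lambda>p. (1 - fst p) * snd (cyl (snd p)))"
    by (intro continuous_map_real_mult continuous_map_diff c2 c3) simp
  moreover have bd: "(fst (cyl (snd p)), (1 - fst p) * snd (cyl (snd p))) \<in> uball (n - 1) \<times> {0..1}"
    if "p \<in> {0..1} \<times> uball n" for p
    using chi_squash[of "fst p" "snd p"] chi_bij(2) that by (metis image_eqI mem_Times_iff)
  ultimately have "continuous_map ?B unit_top (\<lambda>p. (1 - fst p) * snd (cyl (snd p)))"
    by (auto simp: continuous_map_in_subtopology ball_top_eq)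
  with c1 have "continuous_map ?B ?C (\<lambda>p. (fst (cyl (snd p)), (1 - fst p) * snd (cyl (snd p))))"
    by (rule continuous_map_pairedI)
  moreover have "continuous_map ?C (ball_top n) \<psi>"
    using \<psi> by (simp add: homeomorphic_maps_def)
  ultimately have "continuous_map ?B (ball_top n) (\<psi> \<circ> (\<lambda>p. (fst (cyl (snd p)), (1 - fst p) * snd (cyl (snd p)))))"
    by (rule continuous_map_compose)
  moreover have "\<psi> q = inv_into (uball n) cyl q" if "q \<in> uball (n - 1) \<times> {0..1}" for q
  proof -
    have "\<psi> (cyl (inv_into (uball n) cyl q)) = inv_into (uball n) cyl q"
      using \<psi> chi_inv(1)[OF that] by (simp add: homeomorphic_maps_def ball_top_eq)
    then show ?thesis using chi_inv(2)[OF that] by simp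
  qed
  ultimately show ?thesis
    using bd by (elim continuous_map_eq) (auto simp: squash_def ball_top_eq)
qed

lemma f_\<phi>: 
  assumes y: "y \<in> uball n"
  shows "f (\<phi> y) = \<phi> (squash 1 y)"
proof (cases "y \<in> hemi_plus n")
  case True
  then show ?thesis
    using \<phi>_hemi_plus by (simp add: collapse_fun_def Let_def squash_hemi_plus)
next
  case False
  have "inv_into (uball n) \<phi> (\<phi> y) = y"
    using \<phi>_preimage[OF y False] y by (simp add: inv_into_into f_inv_into_f)
  moreover have "\<phi> y \<in> \<alpha>0 \<union> \<alpha>1"
    using \<phi>_cases[OF y False] by blast
  ultimately show ?thesis
    by (simp add: collapse_fun_def Let_def squash_def)
qed

lemma f_Kplus: "x \<in> X closure_of \<alpha>1 \<Longrightarrow> f x \<in> Kplus"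
  using f_\<phi> squash_1 closure_\<alpha>1(2) by auto

lemma f_outside: "x \<notin> \<alpha>0 \<union> \<alpha>1 \<Longrightarrow> f x = x"
  by (simp add: collapse_fun_def Let_def)

lemma Kplus_outside: "x \<in> Kplus \<Longrightarrow> x \<notin> \<alpha>0 \<union> \<alpha>1"
  using \<phi>_hemi_plus by blast

text \<open>The top of the cylinder belongs to the lower hemisphere and projects onto the whole bottom;
  so each point of \<open>Kplus\<close> is hit, not just an open part of it. This is why the image of a
  subcomplex containing \<open>\<alpha>0\<close> is again a union of cells after the collapse.\<close>

lemma f_\<alpha>0: "f ` \<alpha>0 = Kplus"
proof
  show "f ` \<alpha>0 \<subseteq> Kplus"
    using f_Kplus closure_\<alpha>1(1) by blast
  show "Kplus \<subseteq> f ` \<alpha>0"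
  proof
    fix x assume "x \<in> Kplus"
    then obtain z where z: "z \<in> hemi_plus n" "x = \<phi> z" by blast
    then have z': "z \<in> uball n" "snd (cyl z) = 0" "cyl z \<in> uball (n - 1) \<times> {0..1}"
      using hemi_subset hemi_plus_iff chi_bij by blast+
    have "(fst (cyl z), 1) \<in> cyl ` hemi_minus n"
      using chi z'(3) by (auto simp: cylinder_homeo_def mem_Times_iff)
    then obtain y where y: "y \<in> hemi_minus n" "cyl y = (fst (cyl z), 1)" by auto
    then have yb: "y \<in> uball n" using hemi_subset by blast
    have "y \<notin> hemi_plus n"
      using hemi_plus_iff[OF yb] y by simp
    then have "\<phi> y \<in> \<alpha>0" using \<phi>_hemi_minus y by blast
    moreover have "squash 1 y = z"
    proof -
      have "(fst (cyl z), 0) = cyl z" using z'(2) by (simp add: prod_eq_iff)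
      then show ?thesis using y chi_inv(3)[OF z'(1)] by (simp add: squash_def)
    qed
    then have "f (\<phi> y) = x"
      using f_\<phi>[OF yb] z by simp
    ultimately show "x \<in> f ` \<alpha>0" by blast
  qed
qed

text \<open>Points of the ball with the same image are equal or both lie on the upper hemisphere, where
  \<open>squash\<close> is constant in time. So the motion of the ball descends to the closed cell.\<close>

lemma squash_homotopy:
  obtains F where
    "continuous_map (prod_topology unit_top (subtopology X (X closure_of \<alpha>1)))
      (subtopology X (X closure_of \<alpha>1)) F"
    "\<And>s y. s \<in> {0..1} \<Longrightarrow> y \<in> uball n \<Longrightarrow> F (s, \<phi> y) = \<phi> (squash s y)"
proof -
  let ?A = "X closure_of \<alpha>1"
  let ?G = "\<phi> \<circ> (\<lambda>(s, y). squash s y)"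
  have quot: "quotient_map (prod_topology unit_top (ball_top n)) (prod_topology unit_top (subtopology X ?A))
      (\<lambda>(t, x). (t, \<phi> x))"
    unfolding closure_\<alpha>1(2)
    by (intro quotient_map_cylinder quotient_map_ball_image Hausdorff char_continuous \<alpha>_cells)
  have "continuous_map (ball_top n) (subtopology X ?A) \<phi>"
    unfolding closure_\<alpha>1(2)
    by (intro quotient_imp_continuous_map quotient_map_ball_image Hausdorff char_continuous \<alpha>_cells)
  with continuous_squash have G: "continuous_map (prod_topology unit_top (ball_top n)) (subtopology X ?A) ?G"
    by (rule continuous_map_compose)
  have resp: "?G p = ?G q"
    if pq: "p \<in> topspace (prod_topology unit_top (ball_top n))"
      "q \<in> topspace (prod_topology unit_top (ball_top n))"
      "(\<lambda>(t, x). (t, \<phi> x)) p = (\<lambda>(t, x). (t, \<phi> x)) q" for p q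
  proof -
    obtain t x y where [simp]: "p = (t, x)" "q = (t, y)"
      and xy: "x \<in> uball n" "y \<in> uball n" "\<phi> x = \<phi> y"
      using pq by (auto simp: ball_top_eq)
    show ?thesis
    proof (cases "x \<in> hemi_plus n \<and> y \<in> hemi_plus n")
      case True
      then show ?thesis using xy by (simp add: squash_hemi_plus)
    next
      case False
      then have "x = y" using xy \<phi>_preimage by metis
      then show ?thesis by simp
    qed
  qed
  obtain F where F: "continuous_map (prod_topology unit_top (subtopology X ?A)) (subtopology X ?A) F"
    and F\<phi>: "\<And>p. p \<in> topspace (prod_topology unit_top (ball_top n)) \<Longrightarrow> F ((\<lambda>(t, x). (t, \<phi> x)) p) = ?G p"
    by (rule quotient_map_lift_exists[OF quot G], erule (2) resp) (rule that; assumption)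
  show ?thesis
  proof (rule that[OF F])
    show "F (s, \<phi> y) = \<phi> (squash s y)" if "s \<in> {0..1}" "y \<in> uball n" for s y
      using F\<phi>[of "(s, y)"] that by (simp add: ball_top_eq)
  qed
qed

lemma fibre_collapse_ex: "\<exists>F. fibre_collapse X (X closure_of \<alpha>1) f F (collapse_rel chi K (\<alpha>0, \<alpha>1))"
proof -
  obtain F where F: "continuous_map (prod_topology unit_top (subtopology X (X closure_of \<alpha>1)))
      (subtopology X (X closure_of \<alpha>1)) F"
    and F\<phi>: "\<And>s y. s \<in> {0..1} \<Longrightarrow> y \<in> uball n \<Longrightarrow> F (s, \<phi> y) = \<phi> (squash s y)"
    by (rule squash_homotopy) (rule that)
  have "fibre_collapse X (X closure_of \<alpha>1) f F (collapse_rel chi K (\<alpha>0, \<alpha>1))"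
  proof
    show "compact_space X" "Hausdorff_space X" by (fact compact_X Hausdorff)+
    show "closedin X (X closure_of \<alpha>1)" by simp
    show "collapse_rel chi K (\<alpha>0, \<alpha>1) x y \<longleftrightarrow>
        x = y \<or> x \<in> X closure_of \<alpha>1 \<and> y \<in> X closure_of \<alpha>1 \<and> f x = f y" for x y
      by (simp add: collapse_rel_def)
    fix x assume "x \<in> X closure_of \<alpha>1"
    then obtain y where y: "y \<in> uball n" "x = \<phi> y"
      using closure_\<alpha>1(2) by auto
    show "F (0, x) = x" "F (1, x) = f x"
      using y by (simp_all add: F\<phi> squash_0 f_\<phi>)
    show "f (F (t, x)) = f x" if "t \<in> {0..1}" for t
      using that y by (simp add: F\<phi> f_\<phi> chi_squash squash_squash)
  qed (fact F)
  then show ?thesis by (rule exI[of _ F])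
qed

end


section \<open>The collapsed complex is a CW complex\<close>

lemma images_meetE:
  assumes "g ` A \<inter> g ` B \<noteq> {}"
  obtains x where "x \<in> B" "g x \<in> g ` A"
proof -
  obtain z where z: "z \<in> g ` A" "z \<in> g ` B"
    using assms by (auto simp only: ex_in_conv[symmetric] Int_iff)
  obtain x where "z = g x" "x \<in> B"
    using z(2) by (rule imageE)
  with z(1) show ?thesis by (intro that[of x]) simp_all
qed

context adapted_pair
begin

abbreviation "\<kappa> \<equiv> collapse_proj chi K (\<alpha>0, \<alpha>1)"
abbreviation "K' \<equiv> collapse chi K (\<alpha>0, \<alpha>1)"
abbreviation "C \<equiv> cells - {\<alpha>0, \<alpha>1}"

lemma space_K': "cw_space K' = quot_top X (collapse_rel chi K (\<alpha>0, \<alpha>1))"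
  by (simp add: collapse_def Let_def)

lemma
  shows \<kappa>_eq_iff: "\<kappa> x = \<kappa> y \<longleftrightarrow> x = y \<or> (x \<in> X closure_of \<alpha>1 \<and> y \<in> X closure_of \<alpha>1 \<and> f x = f y)"
    and \<kappa>_closed_map: "closed_map X (cw_space K') \<kappa>"
    and \<kappa>_continuous: "continuous_map X (cw_space K') \<kappa>"
    and \<kappa>_surj: "\<kappa> ` topspace X = topspace (cw_space K')"
    and Hausdorff_K': "Hausdorff_space (cw_space K')"
    and homotopy_equivalent_K': "X homotopy_equivalent_space cw_space K'"
proof -
  obtain F where "fibre_collapse X (X closure_of \<alpha>1) f F (collapse_rel chi K (\<alpha>0, \<alpha>1))"
    using fibre_collapse_ex by blast
  then interpret fc: fibre_collapse X "X closure_of \<alpha>1" f F "collapse_rel chi K (\<alpha>0, \<alpha>1)" .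
  note eqs = collapse_proj_def space_K'
  show "\<kappa> x = \<kappa> y \<longleftrightarrow> x = y \<or> (x \<in> X closure_of \<alpha>1 \<and> y \<in> X closure_of \<alpha>1 \<and> f x = f y)"
    unfolding eqs by (rule fc.proj_eq_iff)
  show "closed_map X (cw_space K') \<kappa>"
    unfolding eqs by (rule fc.proj_closed_map)
  show "continuous_map X (cw_space K') \<kappa>"
    unfolding eqs by (rule fc.proj_continuous)
  show "\<kappa> ` topspace X = topspace (cw_space K')"
    unfolding eqs by (rule fc.proj_surj)
  show "Hausdorff_space (cw_space K')"
    unfolding eqs by (rule fc.quotient_Hausdorff)
  obtain S where S: "S \<subseteq> cells" "X closure_of \<alpha>1 = \<Union>S"
    by (rule closure_\<alpha>1_subcomplex)
  moreover have "closedin X (\<Union>S)"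
    using closedin_closure_of[of X \<alpha>1] unfolding S(2) .
  ultimately have "homotopy_extension X (X closure_of \<alpha>1) X"
    using subcomplex_homotopy_extension by simp
  then show "X homotopy_equivalent_space cw_space K'"
    unfolding eqs by (rule fc.homotopy_equivalent_quotient)
qed

lemma collapsed_in_closure: "x \<in> \<alpha>0 \<union> \<alpha>1 \<Longrightarrow> x \<in> X closure_of \<alpha>1"
  using closure_\<alpha>1(1) by blast

lemma \<kappa>_f: "x \<in> X closure_of \<alpha>1 \<Longrightarrow> \<kappa> (f x) = \<kappa> x"
proof -
  assume x: "x \<in> X closure_of \<alpha>1"
  have "f x \<in> Kplus" using x by (rule f_Kplus)
  then have "f x \<in> X closure_of \<alpha>1" "f (f x) = f x"
    using closure_\<alpha>1(1) f_outside Kplus_outside by blast+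
  then show ?thesis using x by (simp add: \<kappa>_eq_iff)
qed

lemma \<kappa>_eq_outside:
  assumes "y \<notin> \<alpha>0 \<union> \<alpha>1" "\<kappa> x = \<kappa> y"
  shows "x = y \<or> (x \<in> \<alpha>0 \<union> \<alpha>1 \<and> f x = y)"
proof (cases "x \<in> \<alpha>0 \<union> \<alpha>1")
  case True
  then have "x \<noteq> y" using assms(1) by blast
  then have "f x = f y" using assms(2) by (simp add: \<kappa>_eq_iff)
  then show ?thesis using True f_outside[OF assms(1)] by simp
next
  case False
  then show ?thesis
    using assms f_outside[OF False] f_outside[OF assms(1)] by (metis \<kappa>_eq_iff)
qed

lemma C_outside: "\<sigma> \<in> C \<Longrightarrow> x \<in> \<sigma> \<Longrightarrow> x \<notin> \<alpha>0 \<union> \<alpha>1"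
  using cells_disjoint \<alpha>_cells by blast

lemma \<kappa>_in_cell:
  assumes "\<sigma> \<in> C" "\<kappa> x \<in> \<kappa> ` \<sigma>"
  shows "x \<in> \<sigma> \<or> (x \<in> \<alpha>0 \<union> \<alpha>1 \<and> f x \<in> \<sigma>)"
proof -
  obtain y where y: "\<kappa> x = \<kappa> y" "y \<in> \<sigma>" using assms(2) by (rule imageE)
  show ?thesis
    using \<kappa>_eq_outside[OF C_outside[OF assms(1) y(2)] y(1)] y(2) by blast
qed

lemma \<kappa>_inj_on_cell: "\<sigma> \<in> C \<Longrightarrow> inj_on \<kappa> \<sigma>"
  using \<kappa>_eq_outside C_outside by (meson inj_onI)

lemma \<kappa>_cells_disjoint:
  assumes "\<sigma> \<in> C" "\<tau> \<in> C" "\<kappa> ` \<sigma> \<inter> \<kappa> ` \<tau> \<noteq> {}"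
  shows "\<sigma> = \<tau>"
proof -
  obtain x where x: "x \<in> \<tau>" "\<kappa> x \<in> \<kappa> ` \<sigma>"
    using assms(3) by (rule images_meetE)
  then have "x \<in> \<sigma>"
    using \<kappa>_in_cell[OF assms(1) x(2)] C_outside[OF assms(2) x(1)] by blast
  then show ?thesis using cells_disjoint x assms by blast
qed

lemma \<kappa>_image_inj: "inj_on ((`) \<kappa>) C"
proof (rule inj_onI)
  fix \<sigma> \<tau> assume "\<sigma> \<in> C" "\<tau> \<in> C" "\<kappa> ` \<sigma> = \<kappa> ` \<tau>"
  then show "\<sigma> = \<tau>"
    using \<kappa>_cells_disjoint[of \<sigma> \<tau>] cells_nonempty by auto
qed

lemma cells_K': "cw_cells K' = (`) \<kappa> ` C"
  by (simp add: collapse_def Let_def)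

lemma
  assumes "\<sigma> \<in> C"
  shows dim_K': "cw_dim K' (\<kappa> ` \<sigma>) = cdim \<sigma>"
    and char_K': "cw_char K' (\<kappa> ` \<sigma>) = \<kappa> \<circ> cchar \<sigma>"
  using inv_into_f_f[OF \<kappa>_image_inj assms] by (simp_all add: collapse_def Let_def)

lemma meets_boundary:
  assumes "\<sigma> \<in> C" "x \<in> X closure_of \<sigma>" "x \<in> \<alpha>0 \<union> \<alpha>1"
  shows "n \<le> cdim \<sigma>" "cdim \<sigma> \<le> n \<Longrightarrow> x \<in> \<alpha>0"
proof -
  have "x \<in> \<alpha>0 \<and> cdim \<alpha>0 < cdim \<sigma> \<or> x \<in> \<alpha>1 \<and> n < cdim \<sigma>"
    using assms closure_of_cell_cases[of \<sigma>] \<alpha>_cells by blast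
  then show "n \<le> cdim \<sigma>" "cdim \<sigma> \<le> n \<Longrightarrow> x \<in> \<alpha>0"
    using dim_\<alpha>1 by auto
qed

text \<open>The collapse does not raise dimensions in boundaries: if the boundary of \<open>\<sigma>\<close> meets \<open>\<alpha>0\<close> or \<open>\<alpha>1\<close>, then
  \<open>\<sigma>\<close> has dimension at least \<open>n\<close>, whereas \<open>f\<close> moves such boundary points to \<open>Kplus\<close>, whose cells have
  dimension below \<open>n\<close>.\<close>

lemma \<kappa>_boundary_lower:
  assumes \<sigma>: "\<sigma> \<in> C" and \<tau>: "\<tau> \<in> C" and y: "y \<in> usphere (cdim \<sigma>)" "\<kappa> (cchar \<sigma> y) \<in> \<kappa> ` \<tau>"
  shows "cdim \<tau> < cdim \<sigma>"
proof -
  let ?x = "cchar \<sigma> y"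
  have cl: "?x \<in> X closure_of \<sigma>"
    using closure_of_cell \<sigma> y(1) usphere_subset_uball by blast
  from \<kappa>_in_cell[OF \<tau> y(2)] show ?thesis
  proof
    assume "?x \<in> \<tau>"
    then show ?thesis using char_sphere_lower \<sigma> \<tau> y(1) by blast
  next
    assume *: "?x \<in> \<alpha>0 \<union> \<alpha>1 \<and> f ?x \<in> \<tau>"
    then have "f ?x \<in> Kplus"
      using f_Kplus collapsed_in_closure by blast
    then have "cdim \<tau> < n"
      using cell_meets_Kplus(1) * \<tau> by blast
    then show ?thesis
      using meets_boundary(1)[OF \<sigma> cl] * by simp
  qed
qed

lemma \<kappa>_covers: "x \<in> topspace X \<Longrightarrow> \<exists>\<sigma>\<in>C. \<kappa> x \<in> \<kappa> ` \<sigma>"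
proof -
  assume x: "x \<in> topspace X"
  show ?thesis
  proof (cases "x \<in> \<alpha>0 \<union> \<alpha>1")
    case True
    then have cl: "x \<in> X closure_of \<alpha>1" by (rule collapsed_in_closure)
    have "f x \<in> Kplus" using cl by (rule f_Kplus)
    moreover have "f x \<in> topspace X"
      using \<open>f x \<in> Kplus\<close> closure_\<alpha>1(1) closure_of_subset_topspace[of X \<alpha>1] by blast
    then obtain \<sigma> where "\<sigma> \<in> cells" "f x \<in> \<sigma>" using topspace_cells by auto
    ultimately have "\<sigma> \<in> C" using cell_meets_Kplus by blast
    then show ?thesis using \<kappa>_f[OF cl] \<open>f x \<in> \<sigma>\<close> by (metis image_eqI)
  next
    case False
    then show ?thesis using x topspace_cells by blast
  qed
qed

lemma char_K'_continuous:
  "\<sigma> \<in> C \<Longrightarrow> continuous_map (ball_top (cdim \<sigma>)) (cw_space K') (\<kappa> \<circ> cchar \<sigma>)"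
  by (rule continuous_map_compose[OF char_continuous \<kappa>_continuous]) simp

text \<open>The new characteristic map is closed on the whole ball, and the open ball is the full preimage of
  the new cell, by the preceding dimension bound. So its restriction to the open ball is closed, too.\<close>

lemma char_K'_homeomorphic:
  assumes \<sigma>: "\<sigma> \<in> C"
  shows "homeomorphic_map (subtopology (Euclidean_space (cdim \<sigma>)) (uball (cdim \<sigma>) - usphere (cdim \<sigma>)))
      (subtopology (cw_space K') (\<kappa> ` \<sigma>)) (\<kappa> \<circ> cchar \<sigma>)"
proof -
  let ?B = "uball (cdim \<sigma>)" and ?S = "usphere (cdim \<sigma>)"
  have int: "cchar \<sigma> ` (?B - ?S) = \<sigma>" using char_interior \<sigma> by blast
  have top: "subtopology (Euclidean_space (cdim \<sigma>)) (?B - ?S) = subtopology (ball_top (cdim \<sigma>)) (?B - ?S)"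
    by (simp add: subtopology_subtopology Int_absorb1)
  have img: "(\<kappa> \<circ> cchar \<sigma>) y \<in> \<kappa> ` \<sigma>" if "y \<in> ?B - ?S" for y
    using int that by auto
  have pre: "{y \<in> topspace (ball_top (cdim \<sigma>)). (\<kappa> \<circ> cchar \<sigma>) y \<in> \<kappa> ` \<sigma>} = ?B - ?S"
  proof -
    have "(\<kappa> \<circ> cchar \<sigma>) y \<notin> \<kappa> ` \<sigma>" if "y \<in> ?S" for y
      using \<kappa>_boundary_lower[OF \<sigma> \<sigma> that] by auto
    with img show ?thesis by (auto simp: ball_top_eq)
  qed
  have "\<sigma> \<subseteq> topspace X" using \<sigma> topspace_cells by auto
  then have sub: "\<kappa> ` \<sigma> \<subseteq> topspace (cw_space K')" using \<kappa>_surj by blast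
  show ?thesis
    unfolding top
  proof (rule bijective_closed_imp_homeomorphic_map)
    show "closed_map (subtopology (ball_top (cdim \<sigma>)) (?B - ?S)) (subtopology (cw_space K') (\<kappa> ` \<sigma>)) (\<kappa> \<circ> cchar \<sigma>)"
      using continuous_imp_closed_map[OF char_K'_continuous[OF \<sigma>] compact_ball_top Hausdorff_K'] pre
      by (rule closed_map_restriction)
    show "continuous_map (subtopology (ball_top (cdim \<sigma>)) (?B - ?S)) (subtopology (cw_space K') (\<kappa> ` \<sigma>)) (\<kappa> \<circ> cchar \<sigma>)"
      unfolding continuous_map_in_subtopology
    proof
      show "continuous_map (subtopology (ball_top (cdim \<sigma>)) (?B - ?S)) (cw_space K') (\<kappa> \<circ> cchar \<sigma>)"
        by (rule continuous_map_from_subtopology[OF char_K'_continuous[OF \<sigma>]])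
      show "\<kappa> \<circ> cchar \<sigma> \<in> topspace (subtopology (ball_top (cdim \<sigma>)) (?B - ?S)) \<rightarrow> \<kappa> ` \<sigma>"
        using img by (simp add: Pi_iff)
    qed
    show "(\<kappa> \<circ> cchar \<sigma>) ` topspace (subtopology (ball_top (cdim \<sigma>)) (?B - ?S)) = topspace (subtopology (cw_space K') (\<kappa> ` \<sigma>))"
    proof -
      have "topspace (subtopology (ball_top (cdim \<sigma>)) (?B - ?S)) = ?B - ?S"
        unfolding ball_top_eq by auto
      moreover have "(\<kappa> \<circ> cchar \<sigma>) ` (?B - ?S) = \<kappa> ` \<sigma>"
        using int by (metis image_comp)
      ultimately show ?thesis using sub by (simp add: Int_absorb1)
    qed
    have "inj_on (\<kappa> \<circ> cchar \<sigma>) (?B - ?S)"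
      using char_inj \<kappa>_inj_on_cell[OF \<sigma>] \<sigma> int by (intro comp_inj_on) auto
    then show "inj_on (\<kappa> \<circ> cchar \<sigma>) (topspace (subtopology (ball_top (cdim \<sigma>)) (?B - ?S)))"
      by (rule inj_on_subset) (auto simp: ball_top_eq)
  qed
qed

lemma finite_cw_K': "finite_cw K'"
  unfolding finite_cw_def
proof (intro conjI ballI)
  show "Hausdorff_space (cw_space K')" by (rule Hausdorff_K')
  show "finite (cw_cells K')" using finite_cells by (simp add: cells_K')
  show "partition_on (topspace (cw_space K')) (cw_cells K')"
  proof (rule partition_onI)
    show "\<Union>(cw_cells K') = topspace (cw_space K')"
    proof
      show "\<Union>(cw_cells K') \<subseteq> topspace (cw_space K')"
        unfolding cells_K' \<kappa>_surj[symmetric] topspace_cells by blast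
      show "topspace (cw_space K') \<subseteq> \<Union>(cw_cells K')"
        unfolding cells_K' \<kappa>_surj[symmetric] using \<kappa>_covers by blast
    qed
    show "disjnt p q" if pq: "p \<in> cw_cells K'" "q \<in> cw_cells K'" "p \<noteq> q" for p q
    proof -
      obtain \<sigma> \<tau> where "\<sigma> \<in> C" "p = \<kappa> ` \<sigma>" "\<tau> \<in> C" "q = \<kappa> ` \<tau>"
        using pq unfolding cells_K' by blast
      then show ?thesis using \<kappa>_cells_disjoint pq(3) unfolding disjnt_def by blast
    qed
    show "{} \<notin> cw_cells K'" unfolding cells_K' using cells_nonempty by auto
  qed
next
  fix s assume "s \<in> cw_cells K'"
  then obtain \<sigma> where \<sigma>: "\<sigma> \<in> C" and s: "s = \<kappa> ` \<sigma>" unfolding cells_K' by blast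
  note eqs = s dim_K'[OF \<sigma>] char_K'[OF \<sigma>]
  show "continuous_map (ball_top (cw_dim K' s)) (cw_space K') (cw_char K' s)"
    unfolding eqs by (rule char_K'_continuous[OF \<sigma>])
  show "homeomorphic_map (subtopology (Euclidean_space (cw_dim K' s)) (uball (cw_dim K' s) - usphere (cw_dim K' s)))
      (subtopology (cw_space K') s) (cw_char K' s)"
    unfolding eqs by (rule char_K'_homeomorphic[OF \<sigma>])
  show "cw_char K' s ` usphere (cw_dim K' s) \<subseteq> \<Union>{\<tau> \<in> cw_cells K'. cw_dim K' \<tau> < cw_dim K' s}"
    unfolding eqs
  proof
    fix z assume "z \<in> (\<kappa> \<circ> cchar \<sigma>) ` usphere (cdim \<sigma>)"
    then obtain y where y: "y \<in> usphere (cdim \<sigma>)" "z = \<kappa> (cchar \<sigma> y)" by auto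
    have "cchar \<sigma> y \<in> topspace X"
      using char_boundary[of \<sigma>] \<sigma> y(1) topspace_cells by blast
    then obtain \<tau> where \<tau>: "\<tau> \<in> C" "z \<in> \<kappa> ` \<tau>" using \<kappa>_covers y(2) by blast
    then have "cdim \<tau> < cdim \<sigma>" using \<kappa>_boundary_lower[OF \<sigma> \<tau>(1) y(1)] y(2) by simp
    then show "z \<in> \<Union>{\<tau> \<in> cw_cells K'. cw_dim K' \<tau> < cdim \<sigma>}"
      using \<tau> unfolding cells_K' by (intro UnionI[of "\<kappa> ` \<tau>"]) (simp_all only: mem_Collect_eq dim_K' imageI simp_thms)
  qed
qed

sublocale K': finite_cw_complex K'
  by unfold_locales (rule finite_cw_K')

lemma closure_K':
  assumes "\<sigma> \<in> C"
  shows "cw_space K' closure_of (\<kappa> ` \<sigma>) = \<kappa> ` (X closure_of \<sigma>)"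
proof -
  have "\<kappa> ` \<sigma> \<in> cw_cells K'" using assms cells_K' by blast
  then show ?thesis
    using K'.closure_of_cell[of "\<kappa> ` \<sigma>"] closure_of_cell[of \<sigma>] assms
    by (simp add: dim_K' char_K' image_comp)
qed

lemma facet_K':
  assumes "\<sigma> \<in> C" "\<tau> \<in> C" "facet K \<tau> \<sigma>"
  shows "facet K' (\<kappa> ` \<tau>) (\<kappa> ` \<sigma>)"
  using assms by (auto simp: facet_def cells_K' dim_K' closure_K')

text \<open>A new incidence arises when \<open>f\<close> pushes a point \<open>x\<close> of the boundary of \<open>\<sigma>\<close> into \<open>\<tau>\<close>. Then
  \<open>cdim \<tau> < n \<le> cdim \<sigma>\<close>; as the two dimensions differ by one, \<open>\<sigma>\<close> has dimension \<open>n\<close>, which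
  leaves \<open>\<alpha>0\<close> as the cell of \<open>x\<close>.\<close>

lemma facet_K'D:
  assumes \<sigma>: "\<sigma> \<in> C" and \<tau>: "\<tau> \<in> C" and facet': "facet K' (\<kappa> ` \<tau>) (\<kappa> ` \<sigma>)"
  shows "facet K \<tau> \<sigma> \<or> facet K \<alpha>0 \<sigma> \<and> facet K \<tau> \<alpha>1"
proof -
  have "\<kappa> ` \<tau> \<inter> \<kappa> ` (X closure_of \<sigma>) \<noteq> {}"
    using facet' closure_K'[OF \<sigma>] by (simp add: facet_def)
  then obtain x where x: "x \<in> X closure_of \<sigma>" "\<kappa> x \<in> \<kappa> ` \<tau>" by (rule images_meetE)
  have d: "cdim \<sigma> = Suc (cdim \<tau>)"
    using facet' \<sigma> \<tau> by (simp add: facet_def dim_K')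
  from \<kappa>_in_cell[OF \<tau> x(2)] show ?thesis
  proof
    assume "x \<in> \<tau>"
    then show ?thesis using x(1) d \<sigma> \<tau> by (auto simp: facet_def)
  next
    assume *: "x \<in> \<alpha>0 \<union> \<alpha>1 \<and> f x \<in> \<tau>"
    then have fx: "f x \<in> Kplus"
      using f_Kplus collapsed_in_closure by blast
    then have "cdim \<tau> < n"
      using cell_meets_Kplus(1) * \<tau> by blast
    moreover have "n \<le> cdim \<sigma>" using meets_boundary(1)[OF \<sigma> x(1)] * by blast
    ultimately have dn: "cdim \<sigma> = n" using d by simp
    then have "x \<in> \<alpha>0" using meets_boundary(2)[OF \<sigma> x(1)] * by simp
    then have "facet K \<alpha>0 \<sigma>"
      using x(1) dn dim_\<alpha>1 \<sigma> \<alpha>_cells by (auto simp: facet_def)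
    moreover have "facet K \<tau> \<alpha>1"
      using * fx dn d \<tau> \<alpha>_cells closure_\<alpha>1(1) by (auto simp: facet_def)
    ultimately show ?thesis by blast
  qed
qed

text \<open>Of a subcomplex \<open>A\<close> that contains \<open>\<alpha>0\<close>, the collapsed cells are mapped into the image of \<open>Kplus\<close>,
  and all of that image is covered already by \<open>\<alpha>0\<close>.\<close>

lemma subcomplex_K':
  assumes "subcomplex K A"
  shows "subcomplex K' (\<kappa> ` A)"
proof -
  obtain T where T: "T \<subseteq> cells" "A = \<Union>T" and A: "closedin X A"
    using assms by (auto simp: subcomplex_def)
  obtain S where S: "S \<subseteq> cells" "\<alpha>0 \<notin> S" "\<alpha>1 \<notin> S" "Kplus = \<Union>S"
    by (rule Kplus_cells)
  have \<alpha>0T: "\<alpha>0 \<in> T" if "\<alpha>1 \<in> T"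
  proof -
    have "X closure_of \<alpha>1 \<subseteq> A"
      using that T(2) A by (intro closure_of_minimal) auto
    then have "\<alpha>0 \<subseteq> \<Union>T" using T(2) closure_\<alpha>1(1) by blast
    then show ?thesis
      using cells_nonempty[OF \<alpha>_cells(1)] cells_disjoint[OF \<alpha>_cells(1)] T(1) by blast
  qed
  define T' where "T' = (T - {\<alpha>0, \<alpha>1}) \<union> (if \<alpha>0 \<in> T then S else {})"
  have T'C: "T' \<subseteq> C"
    using T(1) S by (auto simp: T'_def)
  have "\<kappa> ` A = \<Union>((`) \<kappa> ` T')"
  proof
    show "\<kappa> ` A \<subseteq> \<Union>((`) \<kappa> ` T')"
    proof
      fix z assume "z \<in> \<kappa> ` A"
      then obtain x \<sigma> where x: "z = \<kappa> x" "x \<in> \<sigma>" "\<sigma> \<in> T" using T(2) by blast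
      show "z \<in> \<Union>((`) \<kappa> ` T')"
      proof (cases "\<sigma> \<in> {\<alpha>0, \<alpha>1}")
        case False
        then show ?thesis using x by (auto simp: T'_def)
      next
        case True
        then have \<alpha>0: "\<alpha>0 \<in> T" using x \<alpha>0T by blast
        have cl: "x \<in> X closure_of \<alpha>1" using True x collapsed_in_closure by blast
        have "f x \<in> \<Union>S" using f_Kplus[OF cl] S(4) by simp
        then have "\<kappa> (f x) \<in> \<Union>((`) \<kappa> ` T')" using \<alpha>0 by (auto simp: T'_def)
        then show ?thesis using \<kappa>_f[OF cl] x(1) by simp
      qed
    qed
    show "\<Union>((`) \<kappa> ` T') \<subseteq> \<kappa> ` A"
    proof
      fix z assume "z \<in> \<Union>((`) \<kappa> ` T')"
      then obtain x \<sigma> where x: "z = \<kappa> x" "x \<in> \<sigma>" "\<sigma> \<in> T'" by blast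
      show "z \<in> \<kappa> ` A"
      proof (cases "\<sigma> \<in> T")
        case True
        then show ?thesis using x T(2) by blast
      next
        case False
        then have \<alpha>0: "\<alpha>0 \<in> T" and "\<sigma> \<in> S" using x(3) by (auto simp: T'_def split: if_splits)
        then have "x \<in> f ` \<alpha>0" using x(2) S(4) f_\<alpha>0 by blast
        then obtain w where w: "w \<in> \<alpha>0" "x = f w" by blast
        then have "z = \<kappa> w" using x(1) \<kappa>_f[of w] collapsed_in_closure by simp
        then show ?thesis using w(1) \<alpha>0 T(2) by blast
      qed
    qed
  qed
  moreover have "(`) \<kappa> ` T' \<subseteq> cw_cells K'" using T'C cells_K' by blast
  moreover have "closedin (cw_space K') (\<kappa> ` A)"
    using \<kappa>_closed_map A by (simp add: closed_map_def)
  ultimately show ?thesis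
    unfolding subcomplex_def by blast
qed

end


section \<open>The remaining pairs after a collapse\<close>

text \<open>The graph of a discrete vector field with the field replaced by its set of vectors, and below it the
  invariant of the iterated collapse. A set of pairs is easier to transport along collapses than a
  partition into singletons and doubletons.\<close>

definition matching_digraph :: "'a cw \<Rightarrow> ('a set \<times> 'a set) set \<Rightarrow> ('a set \<times> 'a set) set" where
  "matching_digraph K P = {(\<sigma>, \<tau>). facet K \<tau> \<sigma> \<and> (\<tau>, \<sigma>) \<notin> P} \<union> {(\<tau>, \<sigma>). facet K \<tau> \<sigma> \<and> (\<tau>, \<sigma>) \<in> P}"

definition gradient_pairs :: "'a cw \<Rightarrow> ('a set \<times> 'a set) set \<Rightarrow> bool" where
  "gradient_pairs K P \<longleftrightarrow>
     (\<forall>(\<sigma>, \<tau>)\<in>P. facet K \<sigma> \<tau> \<and> adapted_char K \<sigma> \<tau> (cw_char K \<tau>)) \<and>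
     (\<forall>p\<in>P. \<forall>q\<in>P. {fst p, snd p} \<inter> {fst q, snd q} \<noteq> {} \<longrightarrow> p = q) \<and>
     acyclic (matching_digraph K P)"

lemma gradient_pairsD:
  assumes "gradient_pairs K P" "(\<sigma>, \<tau>) \<in> P"
  shows "facet K \<sigma> \<tau>" "adapted_char K \<sigma> \<tau> (cw_char K \<tau>)"
  using assms by (auto simp: gradient_pairs_def)

lemma gradient_pairs_disjoint:
  assumes "gradient_pairs K P" "(\<sigma>, \<tau>) \<in> P" "(\<sigma>', \<tau>') \<in> P" "{\<sigma>, \<tau>} \<inter> {\<sigma>', \<tau>'} \<noteq> {}"
  shows "\<sigma> = \<sigma>'" "\<tau> = \<tau>'"
proof -
  have "\<forall>p\<in>P. \<forall>q\<in>P. {fst p, snd p} \<inter> {fst q, snd q} \<noteq> {} \<longrightarrow> p = q"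
    using assms(1) by (simp add: gradient_pairs_def)
  from this[rule_format, OF assms(2,3)] assms(4) have "(\<sigma>, \<tau>) = (\<sigma>', \<tau>')"
    by (simp only: fst_conv snd_conv not_False_eq_True simp_thms)
  then show "\<sigma> = \<sigma>'" "\<tau> = \<tau>'" by simp_all
qed

context adapted_pair
begin

text \<open>Acyclicity ensures that the upper hemisphere of a remaining pair still avoids the lower
  cell: a violation makes \<open>\<alpha>0\<close> a facet of \<open>\<beta>1\<close> and \<open>\<beta>0\<close> a facet of \<open>\<alpha>1\<close>, which closes a cycle.\<close>

lemma adapted_K':
  assumes P: "gradient_pairs K P" and \<alpha>: "(\<alpha>0, \<alpha>1) \<in> P"
    and \<beta>: "(\<beta>0, \<beta>1) \<in> P" and C: "\<beta>0 \<in> C" "\<beta>1 \<in> C"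
  shows "adapted_char K' (\<kappa> ` \<beta>0) (\<kappa> ` \<beta>1) (cw_char K' (\<kappa> ` \<beta>1))"
proof -
  let ?m = "cdim \<beta>1"
  have ad: "subcomplex K (cchar \<beta>1 ` usphere ?m)"
    "\<exists>h. homeomorphic_map (subtopology (Euclidean_space ?m) (hemi_minus ?m)) (ball_top (?m - 1)) h \<and>
         (\<forall>x\<in>hemi_minus ?m. cchar \<beta>1 x = cchar \<beta>0 (h x))"
    "cchar \<beta>1 ` hemi_plus ?m \<inter> \<beta>0 = {}"
    using gradient_pairsD(2)[OF P \<beta>] by (simp_all add: adapted_char_def Let_def)
  have f\<beta>: "facet K \<beta>0 \<beta>1" by (rule gradient_pairsD(1)[OF P \<beta>])
  have acyc: "acyclic (matching_digraph K P)" using P by (simp add: gradient_pairs_def)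
  have "\<kappa> (cchar \<beta>1 y) \<notin> \<kappa> ` \<beta>0" if y: "y \<in> hemi_plus ?m" for y
  proof
    assume "\<kappa> (cchar \<beta>1 y) \<in> \<kappa> ` \<beta>0"
    moreover let ?x = "cchar \<beta>1 y"
    have "?x \<notin> \<beta>0" using ad(3) y by blast
    ultimately have x: "?x \<in> \<alpha>0 \<union> \<alpha>1" "f ?x \<in> \<beta>0" using \<kappa>_in_cell[OF C(1)] by blast+
    have "y \<in> uball ?m" using y usphere_subset_uball by (auto simp: hemi_plus_def)
    then have cl: "?x \<in> X closure_of \<beta>1" using closure_of_cell C by blast
    have fx: "f ?x \<in> Kplus" using x(1) f_Kplus collapsed_in_closure by blast
    have "cdim \<beta>0 < n" using cell_meets_Kplus(1) fx x(2) C by blast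
    moreover have "n \<le> ?m" using meets_boundary(1)[OF C(2) cl x(1)] .
    moreover have m: "?m = Suc (cdim \<beta>0)" using f\<beta> by (simp add: facet_def)
    ultimately have mn: "?m = n" by simp
    then have "?x \<in> \<alpha>0" using meets_boundary(2)[OF C(2) cl x(1)] by simp
    then have f1: "facet K \<alpha>0 \<beta>1"
      using cl mn dim_\<alpha>1 \<alpha>_cells C by (auto simp: facet_def)
    have f2: "facet K \<beta>0 \<alpha>1"
      using fx x(2) closure_\<alpha>1(1) mn m \<alpha>_cells C by (auto simp: facet_def)
    have n1: "(\<alpha>0, \<beta>1) \<notin> P"
      using gradient_pairs_disjoint(2)[OF P \<alpha>, of \<alpha>0 \<beta>1] C by blast
    have n2: "(\<beta>0, \<alpha>1) \<notin> P"
      using gradient_pairs_disjoint(1)[OF P \<alpha>, of \<beta>0 \<alpha>1] C by blast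
    have "(\<alpha>1, \<beta>0) \<in> matching_digraph K P" "(\<beta>0, \<beta>1) \<in> matching_digraph K P"
      "(\<beta>1, \<alpha>0) \<in> matching_digraph K P" "(\<alpha>0, \<alpha>1) \<in> matching_digraph K P"
      using f1 f2 n1 n2 f\<beta> \<beta> \<alpha> facet by (auto simp: matching_digraph_def)
    then have "(\<alpha>1, \<alpha>1) \<in> (matching_digraph K P)\<^sup>+"
      by (meson trancl.r_into_trancl trancl_into_trancl)
    then show False using acyc by (simp add: acyclic_def)
  qed
  then have "(\<kappa> \<circ> cchar \<beta>1) ` hemi_plus ?m \<inter> \<kappa> ` \<beta>0 = {}" by auto
  moreover have "subcomplex K' ((\<kappa> \<circ> cchar \<beta>1) ` usphere ?m)"
    using subcomplex_K'[OF ad(1)] by (simp add: image_comp)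
  moreover have "\<exists>h. homeomorphic_map (subtopology (Euclidean_space ?m) (hemi_minus ?m)) (ball_top (?m - 1)) h \<and>
         (\<forall>x\<in>hemi_minus ?m. (\<kappa> \<circ> cchar \<beta>1) x = (\<kappa> \<circ> cchar \<beta>0) (h x))"
    using ad(2) by auto
  ultimately show ?thesis
    by (simp only: adapted_char_def Let_def dim_K'[OF C(2)] char_K'[OF C(1)] char_K'[OF C(2)] simp_thms)
qed

lemma remaining_pairs_in_C:
  assumes P: "gradient_pairs K P" and \<alpha>: "(\<alpha>0, \<alpha>1) \<in> P" and "(\<sigma>, \<tau>) \<in> P - {(\<alpha>0, \<alpha>1)}"
  shows "\<sigma> \<in> C \<and> \<tau> \<in> C"
proof -
  have "\<sigma> \<in> cells" "\<tau> \<in> cells"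
    using gradient_pairsD(1)[OF P] assms(3) by (auto simp: facet_def)
  moreover have "{\<alpha>0, \<alpha>1} \<inter> {\<sigma>, \<tau>} = {}"
    using gradient_pairs_disjoint[OF P \<alpha>, of \<sigma> \<tau>] assms(3) by blast
  ultimately show ?thesis by blast
qed

lemma inj_on_remaining_pairs:
  assumes "gradient_pairs K P" "(\<alpha>0, \<alpha>1) \<in> P"
  shows "inj_on (map_prod ((`) \<kappa>) ((`) \<kappa>)) (P - {(\<alpha>0, \<alpha>1)})"
proof (rule inj_on_subset)
  show "inj_on (map_prod ((`) \<kappa>) ((`) \<kappa>)) (C \<times> C)"
    by (intro map_prod_inj_on \<kappa>_image_inj)
  show "P - {(\<alpha>0, \<alpha>1)} \<subseteq> C \<times> C"
  proof
    fix p assume "p \<in> P - {(\<alpha>0, \<alpha>1)}"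
    then show "p \<in> C \<times> C"
      using remaining_pairs_in_C[OF assms, of "fst p" "snd p"] by (simp add: mem_Times_iff)
  qed
qed

text \<open>A cycle after the collapse lifts to a closed path before it, since each edge lifts to an edge or to a
  path through \<open>\<alpha>0\<close> and \<open>\<alpha>1\<close>.\<close>

lemma gradient_pairs_K':
  assumes P: "gradient_pairs K P" and \<alpha>: "(\<alpha>0, \<alpha>1) \<in> P"
  shows "gradient_pairs K' (map_prod ((`) \<kappa>) ((`) \<kappa>) ` (P - {(\<alpha>0, \<alpha>1)}))"
proof -
  let ?P' = "map_prod ((`) \<kappa>) ((`) \<kappa>) ` (P - {(\<alpha>0, \<alpha>1)})"
  note PC = remaining_pairs_in_C[OF P \<alpha>]
  have src: "inv_into C ((`) \<kappa>) (\<kappa> ` \<sigma>) = \<sigma>" if "\<sigma> \<in> C" for \<sigma>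
    using inv_into_f_f[OF \<kappa>_image_inj that] .
  have P'_iff: "(\<kappa> ` \<tau>, \<kappa> ` \<sigma>) \<in> ?P' \<longleftrightarrow> (\<tau>, \<sigma>) \<in> P" if "\<sigma> \<in> C" "\<tau> \<in> C" for \<sigma> \<tau>
  proof
    assume "(\<kappa> ` \<tau>, \<kappa> ` \<sigma>) \<in> ?P'"
    then obtain \<tau>' \<sigma>' where *: "(\<tau>', \<sigma>') \<in> P - {(\<alpha>0, \<alpha>1)}" "\<kappa> ` \<tau> = \<kappa> ` \<tau>'" "\<kappa> ` \<sigma> = \<kappa> ` \<sigma>'" by auto
    then have "\<tau> = \<tau>'" "\<sigma> = \<sigma>'" using PC[OF *(1)] that src by metis+
    then show "(\<tau>, \<sigma>) \<in> P" using * by simp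
  next
    assume "(\<tau>, \<sigma>) \<in> P"
    then show "(\<kappa> ` \<tau>, \<kappa> ` \<sigma>) \<in> ?P'"
      using that by (intro image_eqI[of _ _ "(\<tau>, \<sigma>)"]) auto
  qed
  let ?G = "matching_digraph K P" and ?G' = "matching_digraph K' ?P'"
  have edge: "(inv_into C ((`) \<kappa>) s, inv_into C ((`) \<kappa>) t) \<in> ?G\<^sup>+" if st: "(s, t) \<in> ?G'" for s t
  proof -
    have "s \<in> cw_cells K'" "t \<in> cw_cells K'"
      using st by (auto simp: matching_digraph_def facet_def)
    then obtain \<sigma> \<tau> where \<sigma>: "\<sigma> \<in> C" "s = \<kappa> ` \<sigma>" and \<tau>: "\<tau> \<in> C" "t = \<kappa> ` \<tau>"
      unfolding cells_K' by blast
    have "(\<sigma>, \<tau>) \<in> ?G\<^sup>+"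
    proof (cases "(\<sigma>, \<tau>) \<in> P")
      case True
      then have "facet K \<sigma> \<tau>" by (rule gradient_pairsD(1)[OF P])
      then show ?thesis using True by (auto simp: matching_digraph_def)
    next
      case False
      then have "facet K' (\<kappa> ` \<tau>) (\<kappa> ` \<sigma>)" and notP: "(\<tau>, \<sigma>) \<notin> P"
        using st P'_iff[OF \<tau>(1) \<sigma>(1)] P'_iff[OF \<sigma>(1) \<tau>(1)] unfolding \<sigma>(2) \<tau>(2)
        by (simp_all add: matching_digraph_def)
      then consider "facet K \<tau> \<sigma>" | "facet K \<alpha>0 \<sigma>" "facet K \<tau> \<alpha>1"
        using facet_K'D[OF \<sigma>(1) \<tau>(1)] by blast
      then show ?thesis
      proof cases
        case 1
        then show ?thesis using notP by (auto simp: matching_digraph_def)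
      next
        case 2
        have "(\<alpha>0, \<sigma>) \<notin> P"
          using gradient_pairs_disjoint(2)[OF P \<alpha>, of \<alpha>0 \<sigma>] \<sigma>(1) by blast
        moreover have "(\<tau>, \<alpha>1) \<notin> P"
          using gradient_pairs_disjoint(1)[OF P \<alpha>, of \<tau> \<alpha>1] \<tau>(1) by blast
        ultimately have "(\<sigma>, \<alpha>0) \<in> ?G" "(\<alpha>0, \<alpha>1) \<in> ?G" "(\<alpha>1, \<tau>) \<in> ?G"
          using 2 \<alpha> facet by (auto simp: matching_digraph_def)
        then show ?thesis
          by (meson trancl.r_into_trancl trancl_into_trancl)
      qed
    qed
    then show ?thesis using src \<sigma> \<tau> by simp
  qed
  have lift: "(inv_into C ((`) \<kappa>) s, inv_into C ((`) \<kappa>) t) \<in> ?G\<^sup>+" if "(s, t) \<in> ?G'\<^sup>+" for s t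
    using that
  proof induction
    case (base t)
    then show ?case by (rule edge)
  next
    case (step t u)
    show ?case using step.IH edge[OF step.hyps(2)] by (rule trancl_trans)
  qed
  have "acyclic ?G" using P by (simp add: gradient_pairs_def)
  have "acyclic ?G'"
    unfolding acyclic_def
  proof (intro allI notI)
    fix s assume "(s, s) \<in> ?G'\<^sup>+"
    then have "(inv_into C ((`) \<kappa>) s, inv_into C ((`) \<kappa>) s) \<in> ?G\<^sup>+" by (rule lift)
    then show False using \<open>acyclic ?G\<close> by (simp add: acyclic_def)
  qed
  have facets: "facet K' s t \<and> adapted_char K' s t (cw_char K' t)" if st: "(s, t) \<in> ?P'" for s t
  proof -
    obtain \<sigma> \<tau> where *: "(\<sigma>, \<tau>) \<in> P - {(\<alpha>0, \<alpha>1)}" "s = \<kappa> ` \<sigma>" "t = \<kappa> ` \<tau>"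
      using st by auto
    have C: "\<sigma> \<in> C" "\<tau> \<in> C" using PC[OF *(1)] by auto
    have "(\<sigma>, \<tau>) \<in> P" using *(1) by blast
    then show ?thesis
      unfolding *(2,3) using facet_K'[OF C(2,1)] gradient_pairsD(1)[OF P] adapted_K'[OF P \<alpha> _ C] by blast
  qed
  have disjoint: "p = q" if pq: "p \<in> ?P'" "q \<in> ?P'" "{fst p, snd p} \<inter> {fst q, snd q} \<noteq> {}" for p q
  proof -
    obtain \<sigma> \<tau> \<sigma>' \<tau>' where *: "(\<sigma>, \<tau>) \<in> P - {(\<alpha>0, \<alpha>1)}" "p = (\<kappa> ` \<sigma>, \<kappa> ` \<tau>)"
      "(\<sigma>', \<tau>') \<in> P - {(\<alpha>0, \<alpha>1)}" "q = (\<kappa> ` \<sigma>', \<kappa> ` \<tau>')"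
      using pq(1,2) by auto
    have "{\<sigma>, \<tau>} \<inter> {\<sigma>', \<tau>'} \<noteq> {}"
      using pq(3) PC[OF *(1)] PC[OF *(3)] src unfolding *(2,4) by simp metis
    then show ?thesis
      using gradient_pairs_disjoint[OF P, of \<sigma> \<tau> \<sigma>' \<tau>'] * by simp
  qed
  show ?thesis
    unfolding gradient_pairs_def
  proof (intro conjI ballI impI)
    show "case p of (s, t) \<Rightarrow> facet K' s t \<and> adapted_char K' s t (cw_char K' t)" if "p \<in> ?P'" for p
      using facets[of "fst p" "snd p"] that by (cases p) simp
  qed (fact disjoint \<open>acyclic ?G'\<close>)+
qed

end


section \<open>Adapted characteristic maps and the Morse complex\<close>

text \<open>Reparametrisations respect the boundary sphere by invariance of domain, and thus the conditions
  on characteristic maps.\<close>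

lemma reparametrised_finite_cw:
  assumes K: "finite_cw K"
    and \<phi>: "\<And>\<sigma>. \<sigma> \<in> cw_cells K \<Longrightarrow> reparam (cw_dim K \<sigma>) (cw_char K \<sigma>) (\<phi> \<sigma>)"
  shows "finite_cw (K\<lparr>cw_char := \<phi>\<rparr>)"
proof -
  interpret finite_cw_complex K by unfold_locales (rule K)
  have "continuous_map (ball_top (cdim \<sigma>)) X (\<phi> \<sigma>) \<and>
      homeomorphic_map (subtopology (Euclidean_space (cdim \<sigma>)) (uball (cdim \<sigma>) - usphere (cdim \<sigma>)))
        (subtopology X \<sigma>) (\<phi> \<sigma>) \<and>
      \<phi> \<sigma> ` usphere (cdim \<sigma>) \<subseteq> \<Union>{\<tau> \<in> cells. cdim \<tau> < cdim \<sigma>}" if \<sigma>: "\<sigma> \<in> cells" for \<sigma>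
  proof (intro conjI)
    let ?B = "uball (cdim \<sigma>)" and ?S = "usphere (cdim \<sigma>)"
    obtain g where g: "homeomorphic_map (ball_top (cdim \<sigma>)) (ball_top (cdim \<sigma>)) g"
      and \<phi>g: "\<forall>x\<in>?B. \<phi> \<sigma> x = cchar \<sigma> (g x)"
      using \<phi>[OF \<sigma>] by (auto simp: reparam_def)
    have gB: "g ` ?B = ?B"
      using homeomorphic_imp_surjective_map[OF g] by (simp add: ball_top_eq)
    note sphere = ball_homeomorphism_sphere_iff[OF g]
    have "continuous_map (ball_top (cdim \<sigma>)) X (cchar \<sigma> \<circ> g)"
      by (rule continuous_map_compose[OF homeomorphic_imp_continuous_map[OF g] char_continuous[OF \<sigma>]])
    then show "continuous_map (ball_top (cdim \<sigma>)) X (\<phi> \<sigma>)"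
      by (rule continuous_map_eq) (use \<phi>g in \<open>simp add: ball_top_eq\<close>)
    have gI: "g ` (?B - ?S) = ?B - ?S"
    proof
      show "g ` (?B - ?S) \<subseteq> ?B - ?S" using sphere gB by blast
      show "?B - ?S \<subseteq> g ` (?B - ?S)"
      proof
        fix y assume y: "y \<in> ?B - ?S"
        then have "y \<in> g ` ?B" using gB by simp
        then obtain x where "y = g x" "x \<in> ?B" by (rule imageE)
        then show "y \<in> g ` (?B - ?S)" using sphere y by simp
      qed
    qed
    have top: "subtopology (ball_top (cdim \<sigma>)) (?B - ?S) = subtopology (Euclidean_space (cdim \<sigma>)) (?B - ?S)"
      by (simp add: subtopology_subtopology Int_absorb1)
    have tops: "topspace (ball_top (cdim \<sigma>)) \<inter> (?B - ?S) = ?B - ?S"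
      unfolding ball_top_eq by auto
    have "homeomorphic_map (subtopology (ball_top (cdim \<sigma>)) (?B - ?S)) (subtopology (ball_top (cdim \<sigma>)) (?B - ?S)) g"
      by (rule homeomorphic_map_subtopologies[OF g]) (simp only: tops gI)
    then have "homeomorphic_map (subtopology (Euclidean_space (cdim \<sigma>)) (?B - ?S)) (subtopology X \<sigma>) (cchar \<sigma> \<circ> g)"
      unfolding top by (rule homeomorphic_map_compose[OF _ char_homeomorphic[OF \<sigma>]])
    then show "homeomorphic_map (subtopology (Euclidean_space (cdim \<sigma>)) (?B - ?S)) (subtopology X \<sigma>) (\<phi> \<sigma>)"
      by (rule homeomorphic_map_eq) (use \<phi>g in simp)
    have "\<phi> \<sigma> y \<in> cchar \<sigma> ` ?S" if "y \<in> ?S" for y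
      using that \<phi>g sphere usphere_subset_uball[of "cdim \<sigma>"] by (metis image_eqI subsetD)
    then have "\<phi> \<sigma> ` ?S \<subseteq> cchar \<sigma> ` ?S" by blast
    then show "\<phi> \<sigma> ` ?S \<subseteq> \<Union>{\<tau> \<in> cells. cdim \<tau> < cdim \<sigma>}"
      using char_boundary[OF \<sigma>] by (rule subset_trans)
  qed
  then show ?thesis
    using K by (simp add: finite_cw_def)
qed

text \<open>If the characteristic map of the lower cell is precomposed with \<open>g\<close>, the identification of the
  hemisphere with the ball is corrected by the inverse of \<open>g\<close>.\<close>

lemma reparametrised_adapted_char:
  assumes "adapted_char K \<sigma> \<tau> \<psi>" and dim: "cw_dim K \<tau> = Suc (cw_dim K \<sigma>)"
    and "reparam (cw_dim K \<sigma>) (cw_char K \<sigma>) (\<phi> \<sigma>)"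
  shows "adapted_char (K\<lparr>cw_char := \<phi>\<rparr>) \<sigma> \<tau> \<psi>"
proof -
  let ?n = "cw_dim K \<tau>"
  obtain h where h: "homeomorphic_map (subtopology (Euclidean_space ?n) (hemi_minus ?n)) (ball_top (?n - 1)) h"
    and \<psi>h: "\<forall>x\<in>hemi_minus ?n. \<psi> x = cw_char K \<sigma> (h x)"
    and rest: "subcomplex K (\<psi> ` usphere ?n)" "\<psi> ` hemi_plus ?n \<inter> \<sigma> = {}"
    using assms(1) by (auto simp: adapted_char_def Let_def)
  obtain g where g: "homeomorphic_map (ball_top (?n - 1)) (ball_top (?n - 1)) g"
    and \<phi>g: "\<forall>x\<in>uball (?n - 1). \<phi> \<sigma> x = cw_char K \<sigma> (g x)"
    using assms(3) dim by (auto simp: reparam_def)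
  obtain k where k: "homeomorphic_maps (ball_top (?n - 1)) (ball_top (?n - 1)) g k"
    using g homeomorphic_map_maps by blast
  then have "homeomorphic_map (ball_top (?n - 1)) (ball_top (?n - 1)) k"
    using homeomorphic_maps_map by blast
  with h have "homeomorphic_map (subtopology (Euclidean_space ?n) (hemi_minus ?n)) (ball_top (?n - 1)) (k \<circ> h)"
    by (rule homeomorphic_map_compose)
  moreover have "\<psi> x = \<phi> \<sigma> ((k \<circ> h) x)" if x: "x \<in> hemi_minus ?n" for x
  proof -
    have "hemi_minus ?n \<subseteq> uball ?n"
      using usphere_subset_uball by (auto simp: hemi_minus_def)
    then have "h x \<in> uball (?n - 1)"
      using homeomorphic_imp_surjective_map[OF h] x
      by (auto simp: subtopology_Euclidean_space_eq)
    then have "k (h x) \<in> uball (?n - 1)" "g (k (h x)) = h x"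
      using k by (auto simp: homeomorphic_maps_def ball_top_eq continuous_map_def)
    then show ?thesis using \<phi>g \<psi>h x by simp
  qed
  moreover have "subcomplex (K\<lparr>cw_char := \<phi>\<rparr>) (\<psi> ` usphere ?n)"
    using rest(1) by (simp add: subcomplex_def)
  ultimately show ?thesis
    using rest(2) by (auto simp: adapted_char_def Let_def simp del: o_apply)
qed

text \<open>A vector is ordered by dimension, whereas a reduction pair is ordered by incidence; the two orderings
  agree since a facet has smaller dimension than its cell.\<close>

lemma vectors_facet:
  assumes V: "discrete_vector_field K V" and v: "(\<sigma>, \<tau>) \<in> vectors K V"
  shows "facet K \<sigma> \<tau>"
proof -
  have D: "{\<sigma>, \<tau>} \<in> V" and lt: "cw_dim K \<sigma> < cw_dim K \<tau>" using v by (auto simp: vectors_def)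
  have "(\<exists>\<rho>. {\<sigma>, \<tau>} = {\<rho>}) \<or> (\<exists>\<rho> \<rho>'. {\<sigma>, \<tau>} = {\<rho>, \<rho>'} \<and> reduction_pair K \<rho> \<rho>')"
    using V D unfolding discrete_vector_field_def by blast
  moreover have "{\<sigma>, \<tau>} \<noteq> {\<rho>}" for \<rho> using lt by auto
  ultimately obtain \<rho> \<rho>' where eq: "{\<sigma>, \<tau>} = {\<rho>, \<rho>'}" and red: "reduction_pair K \<rho> \<rho>'" by blast
  then have f: "facet K \<rho> \<rho>'" by (simp add: reduction_pair_def)
  then have "cw_dim K \<rho> < cw_dim K \<rho>'" by (simp add: facet_def)
  then have "\<sigma> = \<rho>" "\<tau> = \<rho>'" using eq lt by (auto simp: doubleton_eq_iff)
  then show ?thesis using f by simp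
qed

lemma gradient_pairs_vectors:
  assumes V: "acyclic_dvf K V"
    and rep: "\<And>\<sigma>. \<sigma> \<in> cw_cells K \<Longrightarrow> reparam (cw_dim K \<sigma>) (cw_char K \<sigma>) (\<phi> \<sigma>)"
    and ad: "\<And>\<sigma> \<tau>. (\<sigma>, \<tau>) \<in> vectors K V \<Longrightarrow> adapted_char K \<sigma> \<tau> (\<phi> \<tau>)"
  shows "gradient_pairs (K\<lparr>cw_char := \<phi>\<rparr>) (vectors K V)"
proof -
  have dvf: "discrete_vector_field K V" using V by (simp add: acyclic_dvf_def)
  have facet_eq: "facet (K\<lparr>cw_char := \<phi>\<rparr>) = facet K"
    by (intro ext) (simp add: facet_def)
  have "facet K \<sigma> \<tau> \<and> adapted_char (K\<lparr>cw_char := \<phi>\<rparr>) \<sigma> \<tau> (\<phi> \<tau>)" if v: "(\<sigma>, \<tau>) \<in> vectors K V" for \<sigma> \<tau>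
  proof
    show f: "facet K \<sigma> \<tau>" by (rule vectors_facet[OF dvf v])
    then show "adapted_char (K\<lparr>cw_char := \<phi>\<rparr>) \<sigma> \<tau> (\<phi> \<tau>)"
      by (intro reparametrised_adapted_char ad[OF v] rep) (auto simp: facet_def)
  qed
  moreover have "p = q"
    if pq: "p \<in> vectors K V" "q \<in> vectors K V" "{fst p, snd p} \<inter> {fst q, snd q} \<noteq> {}" for p q
  proof -
    have D: "{fst p, snd p} \<in> V" "{fst q, snd q} \<in> V"
      and lt: "cw_dim K (fst p) < cw_dim K (snd p)" "cw_dim K (fst q) < cw_dim K (snd q)"
      using pq by (auto simp: vectors_def)
    have "disjoint V" using dvf by (simp add: discrete_vector_field_def partition_on_def)
    then have "{fst p, snd p} = {fst q, snd q}"
      using D pq(3) by (meson disjointD)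
    then have "fst p = fst q \<and> snd p = snd q"
      using lt by (auto simp: doubleton_eq_iff)
    then show ?thesis by (simp add: prod_eq_iff)
  qed
  moreover have "matching_digraph (K\<lparr>cw_char := \<phi>\<rparr>) (vectors K V) = dvf_graph K V"
    by (simp add: matching_digraph_def dvf_graph_def facet_eq)
  then have "acyclic (matching_digraph (K\<lparr>cw_char := \<phi>\<rparr>) (vectors K V))"
    using V by (simp add: acyclic_dvf_def)
  ultimately show ?thesis
    unfolding gradient_pairs_def facet_eq by auto
qed

lemma morse_complex_homotopy_equivalent:
  assumes chi: "\<And>n. n \<ge> 1 \<Longrightarrow> cylinder_homeo n (chi n)"
    and "finite_cw K" "gradient_pairs K (set \<alpha>s)" "distinct \<alpha>s"
  shows "cw_space K homotopy_equivalent_space cw_space (morse_complex chi K \<alpha>s)"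
  using assms(2-)
proof (induction "length \<alpha>s" arbitrary: K \<alpha>s)
  case 0
  then show ?case by (simp add: homotopy_equivalent_space_refl)
next
  case (Suc k)
  then obtain \<alpha>0 \<alpha>1 \<beta>s where \<alpha>s: "\<alpha>s = (\<alpha>0, \<alpha>1) # \<beta>s" and len: "k = length \<beta>s"
    by (cases \<alpha>s) auto
  have \<alpha>: "(\<alpha>0, \<alpha>1) \<in> set \<alpha>s" using \<alpha>s by simp
  note pair = gradient_pairsD[OF Suc.prems(2) \<alpha>]
  interpret adapted_pair K \<alpha>0 \<alpha>1 chi
  proof
    show "cylinder_homeo (cw_dim K \<alpha>1) (chi (cw_dim K \<alpha>1))"
      using pair(1) by (intro chi) (simp add: facet_def)
  qed (fact Suc.prems(1) pair)+
  let ?\<beta>s = "map (map_prod ((`) \<kappa>) ((`) \<kappa>)) \<beta>s"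
  have \<beta>s: "set \<alpha>s - {(\<alpha>0, \<alpha>1)} = set \<beta>s" "distinct \<beta>s"
    using Suc.prems(3) \<alpha>s by auto
  have "gradient_pairs K' (set ?\<beta>s)"
    using gradient_pairs_K'[OF Suc.prems(2) \<alpha>] \<beta>s(1) by simp
  moreover have "distinct ?\<beta>s"
    using inj_on_remaining_pairs[OF Suc.prems(2) \<alpha>] \<beta>s by (simp add: distinct_map)
  moreover have "k = length ?\<beta>s" using len by simp
  ultimately have "cw_space K' homotopy_equivalent_space cw_space (morse_complex chi K' ?\<beta>s)"
    using Suc.hyps(1)[of ?\<beta>s K'] finite_cw_K' by blast
  then show ?case
    unfolding \<alpha>s morse_complex.simps using homotopy_equivalent_K' homotopy_eqv_trans by blast
qed

theorem corollary3p11: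
  fixes K :: "'a cw"
    and V :: "'a set set set"
    and \<phi> :: "'a set \<Rightarrow> (nat \<Rightarrow> real) \<Rightarrow> 'a"
    and chi :: "nat \<Rightarrow> (nat \<Rightarrow> real) \<Rightarrow> (nat \<Rightarrow> real) \<times> real"
    and \<alpha>s :: "('a set \<times> 'a set) list"
  assumes "finite_cw K"
    and "acyclic_dvf K V"
    and "\<And>n. n \<ge> 1 \<Longrightarrow> cylinder_homeo n (chi n)"
    and "\<And>\<sigma>. \<sigma> \<in> cw_cells K \<Longrightarrow> reparam (cw_dim K \<sigma>) (cw_char K \<sigma>) (\<phi> \<sigma>)"
    and "\<And>\<sigma> \<tau>. (\<sigma>, \<tau>) \<in> vectors K V \<Longrightarrow> adapted_char K \<sigma> \<tau> (\<phi> \<tau>)"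
    and "distinct \<alpha>s" and "set \<alpha>s = vectors K V"
  shows "cw_space K homotopy_equivalent_space
         cw_space (morse_complex chi (K\<lparr>cw_char := \<phi>\<rparr>) \<alpha>s)"
proof -
  have "finite_cw (K\<lparr>cw_char := \<phi>\<rparr>)"
    using assms(1,4) by (rule reparametrised_finite_cw)
  moreover have "gradient_pairs (K\<lparr>cw_char := \<phi>\<rparr>) (set \<alpha>s)"
    unfolding assms(7) using assms(2,4,5) by (rule gradient_pairs_vectors)
  ultimately have "cw_space (K\<lparr>cw_char := \<phi>\<rparr>) homotopy_equivalent_space
         cw_space (morse_complex chi (K\<lparr>cw_char := \<phi>\<rparr>) \<alpha>s)"
    using assms(3,6) by (intro morse_complex_homotopy_equivalent)
  then show ?thesis by simp
qed

end
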